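(* Let $\Gamma\le\mathrm{SL}_2(\mathbb{Q})$ be commensurable with $\mathrm{SL}_2(\mathbb{Z})$, let $k>0$ and $w\in\mathbb{C}\setminus\mathbb{R}$. Regarding $\Psi_{\Gamma,k}(z,w)(X-zY)^k\,dz$ as a meromorphic one-form in $z$ with values in $\mathbb{C}[X,Y,U,V]$, we have $$\mathrm{Res}_{z=w}\,\Psi_{\Gamma,k}(z,w)(X-zY)^k\,dz=\sum_{\gamma\in\Gamma_w}(XV-YU)^k\big|_{(\gamma,1)}=\sum_{\gamma\in\Gamma_w}(XV-YU)^k\big|_{(1,\gamma)} .$$ In particular this residue lies in $(V_k^{\mathrm B}\otimes V_k^{\mathrm B})^{\Gamma_w}$, the $\Gamma_w$-invariants of the $\mathbb{Q}$-space of polynomials homogeneous of degree $k$ in $X,Y$ and of degree $k$ in $U,V$ with rational coefficients.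
   Context: $j_\gamma(z)=cz+d$ for $\gamma=\begin{psmallmatrix}a&b\\c&d\end{psmallmatrix}$. $\psi^{p,q}(z,w)=\frac{w-\overline{w}}{(z-w)^{p+1}(z-\overline w)^{q+1}}$, and for $p+q>0$, $z\notin\Gamma w\cup\Gamma\overline w$, $\Psi^{p,q}_\Gamma(z,w)=\sum_{\gamma\in\Gamma}j_\gamma(z)^{-(p+q+2)}\psi^{p,q}(\gamma z,w)$ (normally convergent). $\Psi_{\Gamma,k}(z,w)=\sum_{p+q=k,\,p,q\ge0}\Psi^{p,q}_\Gamma(z,w)(U-wV)^p(U-\overline wV)^q$. $\Gamma_w$ is the stabiliser of $w$ in $\Gamma$. The right action on polynomials is $(X,Y)|_\gamma=(aX+bY,cX+dY)$; $(\gamma,1)$ acts this way on $(X,Y)$ and trivially on $(U,V)$, and $(1,\gamma)$ acts on $(U,V)$ only. *)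

theory Defs
  imports
    "HOL-Complex_Analysis.Complex_Analysis"
    "HOL-Algebra.Coset"
    "HOL-Library.Poly_Mapping"
begin

definition SL2Q :: "(rat^2^2) monoid" where
  "SL2Q = \<lparr>carrier = {A. det A = 1}, mult = (**), one = mat 1\<rparr>"

definition SL2Z :: "(rat^2^2) set" where
  "SL2Z = {A. det A = 1 \<and> (\<forall>i j. A $ i $ j \<in> \<int>)}"

definition commensurable :: "('a, 'b) monoid_scheme \<Rightarrow> 'a set \<Rightarrow> 'a set \<Rightarrow> bool" where
  "commensurable G H K \<longleftrightarrow>
     finite (rcosets\<^bsub>G\<lparr>carrier := H\<rparr>\<^esub> (H \<inter> K)) \<and>
     finite (rcosets\<^bsub>G\<lparr>carrier := K\<rparr>\<^esub> (H \<inter> K))"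

definition jfac :: "rat^2^2 \<Rightarrow> complex \<Rightarrow> complex" where
  "jfac \<gamma> z = of_rat (\<gamma> $ 2 $ 1) * z + of_rat (\<gamma> $ 2 $ 2)"

definition moebius :: "rat^2^2 \<Rightarrow> complex \<Rightarrow> complex" where
  "moebius \<gamma> z = (of_rat (\<gamma> $ 1 $ 1) * z + of_rat (\<gamma> $ 1 $ 2)) / jfac \<gamma> z"

definition stab :: "(rat^2^2) set \<Rightarrow> complex \<Rightarrow> (rat^2^2) set" where
  "stab \<Gamma> w = {\<gamma> \<in> \<Gamma>. moebius \<gamma> w = w}"

definition psi :: "nat \<Rightarrow> nat \<Rightarrow> complex \<Rightarrow> complex \<Rightarrow> complex" where
  "psi p q z w = (w - cnj w) / ((z - w) ^ (p + 1) * (z - cnj w) ^ (q + 1))"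

definition Psi :: "(rat^2^2) set \<Rightarrow> nat \<Rightarrow> nat \<Rightarrow> complex \<Rightarrow> complex \<Rightarrow> complex" where
  "Psi \<Gamma> p q z w = (\<Sum>\<^sub>\<infinity>\<gamma>\<in>\<Gamma>. psi p q (moebius \<gamma> z) w / jfac \<gamma> z ^ (p + q + 2))"

text \<open>
  The ring C[X,Y,U,V]: finitely supported complex coefficient functions on the
  monomials, a monomial being an exponent vector on the four indeterminates.
\<close>

datatype indet = IX | IY | IU | IV

type_synonym cpoly4 = "(indet \<Rightarrow>\<^sub>0 nat) \<Rightarrow>\<^sub>0 complex"

definition Const :: "complex \<Rightarrow> cpoly4" where
  "Const c = Poly_Mapping.single 0 c"

definition Indet :: "indet \<Rightarrow> cpoly4" where
  "Indet v = Poly_Mapping.single (Poly_Mapping.single v 1) 1"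

definition poly_subst :: "(indet \<Rightarrow> cpoly4) \<Rightarrow> cpoly4 \<Rightarrow> cpoly4" where
  "poly_subst \<sigma> P =
     (\<Sum>m\<in>Poly_Mapping.keys P. Const (Poly_Mapping.lookup P m) *
        (\<Prod>v\<in>Poly_Mapping.keys m. \<sigma> v ^ Poly_Mapping.lookup m v))"

fun lin_subst :: "rat^2^2 \<Rightarrow> rat^2^2 \<Rightarrow> indet \<Rightarrow> cpoly4" where
  "lin_subst \<gamma> \<delta> IX =
     Const (of_rat (\<gamma> $ 1 $ 1)) * Indet IX + Const (of_rat (\<gamma> $ 1 $ 2)) * Indet IY"
| "lin_subst \<gamma> \<delta> IY =
     Const (of_rat (\<gamma> $ 2 $ 1)) * Indet IX + Const (of_rat (\<gamma> $ 2 $ 2)) * Indet IY"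
| "lin_subst \<gamma> \<delta> IU =
     Const (of_rat (\<delta> $ 1 $ 1)) * Indet IU + Const (of_rat (\<delta> $ 1 $ 2)) * Indet IV"
| "lin_subst \<gamma> \<delta> IV =
     Const (of_rat (\<delta> $ 2 $ 1)) * Indet IU + Const (of_rat (\<delta> $ 2 $ 2)) * Indet IV"

text \<open>\<open>slash P \<gamma> \<delta>\<close> is the right action of the pair \<open>(\<gamma>, \<delta>)\<close>: \<open>\<gamma>\<close> acts on (X,Y), \<open>\<delta>\<close> on (U,V).\<close>

definition slash :: "cpoly4 \<Rightarrow> rat^2^2 \<Rightarrow> rat^2^2 \<Rightarrow> cpoly4" where
  "slash P \<gamma> \<delta> = poly_subst (lin_subst \<gamma> \<delta>) P"

definition Psi_poly :: "(rat^2^2) set \<Rightarrow> nat \<Rightarrow> complex \<Rightarrow> complex \<Rightarrow> cpoly4" where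
  "Psi_poly \<Gamma> k z w =
     (\<Sum>(p, q)\<in>{(p, q). p + q = k}.
        Const (Psi \<Gamma> p q z w)
        * (Indet IU - Const w * Indet IV) ^ p
        * (Indet IU - Const (cnj w) * Indet IV) ^ q)"

text \<open>
  A polynomial-valued one-form \<open>F z dz\<close> is represented by its coefficient function \<open>F\<close>;
  meromorphy and residues are taken coefficientwise. The residue is a genuine polynomial
  only if almost all coefficients have residue zero, e.g. when the degree of \<open>F z\<close> is bounded.
\<close>

definition poly_meromorphic_on :: "(complex \<Rightarrow> cpoly4) \<Rightarrow> complex set \<Rightarrow> bool" where
  "poly_meromorphic_on F S \<longleftrightarrow> (\<forall>m. (\<lambda>z. Poly_Mapping.lookup (F z) m) meromorphic_on S)"

definition poly_residue :: "(complex \<Rightarrow> cpoly4) \<Rightarrow> complex \<Rightarrow> cpoly4" where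
  "poly_residue F w = Abs_poly_mapping (\<lambda>m. residue (\<lambda>z. Poly_Mapping.lookup (F z) m) w)"

definition Psi_form :: "(rat^2^2) set \<Rightarrow> nat \<Rightarrow> complex \<Rightarrow> complex \<Rightarrow> cpoly4" where
  "Psi_form \<Gamma> k w z = Psi_poly \<Gamma> k z w * (Indet IX - Const z * Indet IY) ^ k"

text \<open>
  The rational space \<open>V\<^sub>k \<otimes> V\<^sub>k\<close>, realised inside C[X,Y,U,V] as the bihomogeneous
  polynomials of bidegree \<open>(k, k)\<close> with rational coefficients.
\<close>

definition VkVk :: "nat \<Rightarrow> cpoly4 set" where
  "VkVk k = {P. \<forall>m\<in>Poly_Mapping.keys P. Poly_Mapping.lookup P m \<in> \<rat> \<and>
                   Poly_Mapping.lookup m IX + Poly_Mapping.lookup m IY = k \<and>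
                   Poly_Mapping.lookup m IU + Poly_Mapping.lookup m IV = k}"

text \<open>Invariants for the diagonal action on the tensor product.\<close>

definition VkVk_invariants :: "nat \<Rightarrow> (rat^2^2) set \<Rightarrow> cpoly4 set" where
  "VkVk_invariants k G = {P \<in> VkVk k. \<forall>\<gamma>\<in>G. slash P \<gamma> \<gamma> = P}"

end

theory Submission imports Defs begin

text \<open>
  Write \<open>f\<^sub>\<gamma>(z) = (az + b) - w(cz + d)\<close> and \<open>g\<^sub>\<gamma>\<close> for the same expression with \<open>w\<close> replaced by its
  conjugate, so that the \<open>\<gamma>\<close>-summand of \<open>\<Psi>\<^sup>p\<^sup>,\<^sup>q\<close> is \<open>(w - cnj w) / (f\<^sub>\<gamma>\<^sup>p\<^sup>+\<^sup>1 g\<^sub>\<gamma>\<^sup>q\<^sup>+\<^sup>1)\<close>. Since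
  the imaginary part of \<open>(az + b) cnj (cz + d)\<close> is that of \<open>z\<close>, both factors are bounded below by a
  multiple of the height of \<open>\<gamma>\<close>, locally uniformly in \<open>z\<close> and for all but finitely many \<open>\<gamma>\<close>; the sum of
  the inverse cubes of the heights converges over SL2(Z), hence over \<open>\<Gamma>\<close>. So near any
  non-real point the form is a finite sum of rational forms plus a holomorphic one, and at \<open>w\<close> only
  the summands with \<open>\<gamma>\<close> in the stabiliser have a pole.

  For the identity summand put \<open>\<alpha> = 1/(z - w)\<close>, \<open>\<beta> = 1/(z - cnj w)\<close>, \<open>a = \<alpha>(U - wV)\<close>, \<open>b = \<beta>(U - cnj w V)\<close>.
  As \<open>a - V\<close> and \<open>b - V\<close> are \<open>\<alpha>\<close> and \<open>\<beta>\<close> times \<open>U - zV\<close>, the sum of all \<open>(\<alpha> - \<beta>) a\<^sup>p b\<^sup>q\<close> splits into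
  \<open>\<alpha> \<Sum> a\<^sup>i V\<^sup>j\<close>, which carries the pole at \<open>w\<close>, and \<open>\<beta> \<Sum> b\<^sup>i V\<^sup>j\<close>, which is regular there. Multiplying the
  former by \<open>(X - zY)\<^sup>k\<close>, expanded in \<open>z - w\<close>, gives the residue
  \<open>(V(X - wY) - Y(U - wV))\<^sup>k = (XV - YU)\<^sup>k\<close>. A stabilising \<open>\<gamma>\<close> multiplies \<open>U - wV\<close> and \<open>U - cnj w V\<close> by
  inverse scalars, so its summand is the identity summand after a linear substitution in \<open>(U, V)\<close>.
\<close>

unbundle no fps_syntax

section \<open>Convergence\<close>

definition height :: "rat^2^2 \<Rightarrow> real" where
  "height \<gamma> = (\<Sum>i\<in>UNIV. \<Sum>j\<in>UNIV. \<bar>real_of_rat (\<gamma> $ i $ j)\<bar>)"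

lemma height_2:
  "height \<gamma> = \<bar>real_of_rat (\<gamma> $ 1 $ 1)\<bar> + \<bar>real_of_rat (\<gamma> $ 1 $ 2)\<bar>
     + \<bar>real_of_rat (\<gamma> $ 2 $ 1)\<bar> + \<bar>real_of_rat (\<gamma> $ 2 $ 2)\<bar>"
  by (simp add: height_def sum_2)

lemma height_nonneg: "0 \<le> height \<gamma>"
  by (simp add: height_2)

lemma height_pos:
  assumes "det \<gamma> = 1"
  shows "0 < height \<gamma>"
proof (rule ccontr)
  assume "\<not> 0 < height \<gamma>"
  hence "\<bar>real_of_rat (\<gamma> $ 1 $ 1)\<bar> = 0" "\<bar>real_of_rat (\<gamma> $ 1 $ 2)\<bar> = 0"
    unfolding height_2 by linarith+
  hence "\<gamma> $ 1 $ 1 = 0 \<and> \<gamma> $ 1 $ 2 = 0" by simp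
  thus False using assms by (simp add: det_2)
qed

text \<open>The eight products bounding the entries of \<open>A ** B\<close> all occur among the
  sixteen nonnegative products in the expanded right side. This makes heights comparable across a
  coset.\<close>

lemma height_mult: "height (A ** B) \<le> height A * height B"
proof -
  have tri: "\<bar>p * q + r * s\<bar> \<le> \<bar>p\<bar> * \<bar>q\<bar> + \<bar>r\<bar> * \<bar>s\<bar>" for p q r s :: real
    by (metis abs_mult abs_triangle_ineq)
  have *: "\<bar>real_of_rat ((A ** B) $ i $ j)\<bar> \<le>
      \<bar>real_of_rat (A $ i $ 1)\<bar> * \<bar>real_of_rat (B $ 1 $ j)\<bar> + \<bar>real_of_rat (A $ i $ 2)\<bar> * \<bar>real_of_rat (B $ 2 $ j)\<bar>" for i j
    using tri by (simp only: matrix_matrix_mult_def vec_lambda_beta sum_2 of_rat_add of_rat_mult)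
  define a where "a i j = \<bar>real_of_rat (A $ i $ j)\<bar>" for i j
  define b where "b i j = \<bar>real_of_rat (B $ i $ j)\<bar>" for i j
  have nn: "0 \<le> a i j * b i' j'" for i j i' j' by (simp add: a_def b_def)
  have "height (A ** B) \<le> (a 1 1 * b 1 1 + a 1 2 * b 2 1) + (a 1 1 * b 1 2 + a 1 2 * b 2 2)
      + (a 2 1 * b 1 1 + a 2 2 * b 2 1) + (a 2 1 * b 1 2 + a 2 2 * b 2 2)"
    unfolding height_2 a_def b_def by (intro add_mono *)
  also have "\<dots> \<le> (a 1 1 + a 1 2 + a 2 1 + a 2 2) * (b 1 1 + b 1 2 + b 2 1 + b 2 2)"
    using nn[of 1 1 2 1] nn[of 1 1 2 2] nn[of 1 2 1 1] nn[of 1 2 1 2]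
      nn[of 2 1 2 1] nn[of 2 1 2 2] nn[of 2 2 1 1] nn[of 2 2 1 2]
    by (simp add: algebra_simps)
  finally show ?thesis by (simp add: height_2 a_def b_def)
qed

lemma of_real_of_rat [simp]: "complex_of_real (real_of_rat x) = of_rat x"
  by (cases x) (simp add: of_rat_rat)

lemma Re_of_rat [simp]: "Re (of_rat x) = of_rat x" and Im_of_rat [simp]: "Im (of_rat x) = 0"
  by (metis of_real_of_rat Re_complex_of_real, metis of_real_of_rat Im_complex_of_real)

section \<open>Inverse cubes of heights over SL2(Z)\<close>

lemma summable_on_int_even:
  fixes f :: "int \<Rightarrow> real"
  assumes "summable (\<lambda>n. f (int n))" "\<And>x. 0 \<le> f x" "\<And>x. f (- x) = f x"
  shows "f summable_on UNIV"
proof -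
  have s: "(\<lambda>n. f (int n)) summable_on UNIV"
    using assms by (subst summable_on_UNIV_nonneg_real_iff) auto
  have 1: "f summable_on range int"
    using s by (subst summable_on_reindex) (auto simp: o_def)
  have 2: "f summable_on range (\<lambda>n. - int n)"
    using s assms(3) by (subst summable_on_reindex) (auto simp: o_def inj_def)
  have "UNIV = range int \<union> range (\<lambda>n. - int n)"
  proof -
    have "x \<in> range int \<union> range (\<lambda>n. - int n)" for x by (cases x rule: int_cases2) auto
    thus ?thesis by blast
  qed
  thus ?thesis using summable_on_union[OF 1 2] by simp
qed

text \<open>The exponent 3/2 exceeds 1, so the sum over the integers converges, and it is half of 3,
  so one inverse cube pays for two indices. The maximum matters at \<open>n = 0\<close>, where
  \<open>powr\<close> would return 0.\<close>

definition decay :: "int \<Rightarrow> real" where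
  "decay n = max 1 (real_of_int \<bar>n\<bar>) powr (-3/2)"

lemma decay_summable: "decay summable_on UNIV"
proof (rule summable_on_int_even)
  have "summable (\<lambda>n. real n powr (-3/2))"
    by (subst summable_real_powr_iff) simp
  hence "summable (\<lambda>n. real (Suc n) powr (-3/2))"
    by (subst summable_Suc_iff)
  moreover have "decay (int (Suc n)) = real (Suc n) powr (-3/2)" for n
    by (simp add: decay_def max_def)
  ultimately have "summable (\<lambda>n. decay (int (Suc n)))" by simp
  thus "summable (\<lambda>n. decay (int n))" by (subst (asm) summable_Suc_iff)
qed (auto simp: decay_def)

lemma decay_triple_summable: "(\<lambda>(c, d, n). decay c * (decay d * decay n)) summable_on UNIV"
proof -
  have nn: "0 \<le> decay n" for n by (simp add: decay_def)
  have 1: "(\<lambda>(d, n). decay d * decay n) summable_on UNIV \<times> UNIV"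
    by (rule summable_on_SigmaI[where g = "\<lambda>d. decay d * infsum decay UNIV"])
       (auto simp: nn intro!: has_sum_cmult_right has_sum_infsum decay_summable summable_on_cmult_left)
  have "(\<lambda>(c, dn). decay c * (case dn of (d, n) \<Rightarrow> decay d * decay n)) summable_on UNIV \<times> UNIV"
    by (rule summable_on_SigmaI[where g = "\<lambda>c. decay c * infsum (\<lambda>(d, n). decay d * decay n) UNIV"])
       (use 1 in \<open>auto simp: nn intro!: has_sum_cmult_right has_sum_infsum decay_summable summable_on_cmult_left\<close>)
  thus ?thesis by (simp add: case_prod_unfold)
qed

text \<open>
  For a fixed bottom row \<open>(c, d)\<close> the top rows differ by integer multiples of \<open>(c, d)\<close>, so the floor of
  the quotient over the larger entry of the bottom row determines the matrix.
\<close>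

definition row_floor :: "rat^2^2 \<Rightarrow> int" where
  "row_floor \<gamma> = (if \<bar>\<gamma> $ 2 $ 2\<bar> \<le> \<bar>\<gamma> $ 2 $ 1\<bar> then \<lfloor>\<gamma> $ 1 $ 1 / \<gamma> $ 2 $ 1\<rfloor> else \<lfloor>\<gamma> $ 1 $ 2 / \<gamma> $ 2 $ 2\<rfloor>)"

definition SL2Z_code :: "rat^2^2 \<Rightarrow> int \<times> int \<times> int" where
  "SL2Z_code \<gamma> = (\<lfloor>\<gamma> $ 2 $ 1\<rfloor>, \<lfloor>\<gamma> $ 2 $ 2\<rfloor>, row_floor \<gamma>)"

lemma SL2Z_code_inj: "inj_on SL2Z_code SL2Z"
proof (rule inj_onI)
  fix A B assume A: "A \<in> SL2Z" and B: "B \<in> SL2Z" and eq: "SL2Z_code A = SL2Z_code B"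
  have int: "A $ i $ j \<in> \<int>" "B $ i $ j \<in> \<int>" for i j using A B by (auto simp: SL2Z_def)
  have row2: "A $ 2 $ j = B $ 2 $ j" for j
  proof -
    have "\<lfloor>A $ 2 $ j\<rfloor> = \<lfloor>B $ 2 $ j\<rfloor>"
      using eq exhaust_2[of j] by (auto simp: SL2Z_code_def)
    thus ?thesis using int[of 2 j] by (auto elim!: Ints_cases)
  qed
  \<comment> \<open>Two rows completing the same bottom row to determinant 1 differ by a multiple of
    it; eliminating between the two determinant equations gives this multiplier, which is an
    integer.\<close>
  define t where "t = B $ 1 $ 1 * A $ 1 $ 2 - A $ 1 $ 1 * B $ 1 $ 2"
  have dA: "A $ 1 $ 1 * A $ 2 $ 2 - A $ 1 $ 2 * A $ 2 $ 1 = 1"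
    and dB: "B $ 1 $ 1 * A $ 2 $ 2 - B $ 1 $ 2 * A $ 2 $ 1 = 1"
    using A B by (simp_all add: SL2Z_def det_2 row2)
  have t1: "A $ 1 $ 1 - B $ 1 $ 1 = t * A $ 2 $ 1" and t2: "A $ 1 $ 2 - B $ 1 $ 2 = t * A $ 2 $ 2"
    unfolding t_def using dA dB by algebra+
  have tint: "t \<in> \<int>" unfolding t_def by (intro Ints_diff Ints_mult int)
  \<comment> \<open>The quotients by the larger bottom entry differ by exactly \<open>t\<close>, and
    an integer shift moves the floor by itself.\<close>
  have small: "t = 0" if "\<lfloor>x\<rfloor> = \<lfloor>y\<rfloor>" "x - y = t" for x y
  proof -
    from tint obtain l where l: "t = of_int l" by (auto elim: Ints_cases)
    hence "x = y + of_int l" using that by simp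
    hence "\<lfloor>x\<rfloor> = \<lfloor>y\<rfloor> + l" by (simp only: floor_add_int)
    thus ?thesis using l that(1) by simp
  qed
  have "t = 0"
  proof (cases "\<bar>A $ 2 $ 2\<bar> \<le> \<bar>A $ 2 $ 1\<bar>")
    case True
    hence nz: "A $ 2 $ 1 \<noteq> 0" using dA by auto
    show ?thesis
      by (rule small[of "A $ 1 $ 1 / A $ 2 $ 1" "B $ 1 $ 1 / A $ 2 $ 1"])
         (use True eq nz t1 in \<open>auto simp: SL2Z_code_def row_floor_def row2 field_simps\<close>)
  next
    case False
    hence nz: "A $ 2 $ 2 \<noteq> 0" by auto
    show ?thesis
      by (rule small[of "A $ 1 $ 2 / A $ 2 $ 2" "B $ 1 $ 2 / A $ 2 $ 2"])
         (use False eq nz t2 in \<open>auto simp: SL2Z_code_def row_floor_def row2 field_simps\<close>)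
  qed
  thus "A = B" using t1 t2 row2 by (simp add: vec_eq_iff forall_2)
qed

text \<open>The inverse cube is the square of \<open>M powr (-3/2)\<close>; each factor is compared
  with one of \<open>x\<close>, \<open>y\<close>.\<close>

lemma inverse_cube_le_powr:
  fixes M x y :: real
  assumes "1 \<le> x" "1 \<le> y" "x \<le> M" "y \<le> M"
  shows "1 / M ^ 3 \<le> x powr (-3/2) * y powr (-3/2)"
proof -
  have "M powr (-3/2) \<le> x powr (-3/2)" "M powr (-3/2) \<le> y powr (-3/2)"
    using assms by (auto intro!: powr_mono2')
  hence "M powr (-3/2) * M powr (-3/2) \<le> x powr (-3/2) * y powr (-3/2)"
    by (intro mult_mono) auto
  moreover have "M powr (-3/2) * M powr (-3/2) = 1 / M ^ 3"
    using assms by (simp add: powr_add[symmetric] powr_minus_divide powr_numeral)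
  ultimately show ?thesis by simp
qed

text \<open>The subtracted 1 pays for negative quotients, whose floor can be larger in absolute
  value, by less than 1.\<close>

lemma floor_div_bound:
  fixes a c :: rat
  assumes "c \<noteq> 0"
  shows "(real_of_int \<bar>\<lfloor>a / c\<rfloor>\<bar> - 1) * \<bar>real_of_rat c\<bar> \<le> \<bar>real_of_rat a\<bar>"
proof -
  have "rat_of_int \<bar>\<lfloor>a / c\<rfloor>\<bar> - 1 \<le> \<bar>a / c\<bar>"
    by (simp add: abs_if) linarith
  hence "(rat_of_int \<bar>\<lfloor>a / c\<rfloor>\<bar> - 1) * \<bar>c\<bar> \<le> \<bar>a / c\<bar> * \<bar>c\<bar>"
    by (intro mult_right_mono) auto
  also have "\<dots> = \<bar>a\<bar>" using assms by (simp only: abs_mult[symmetric]) simp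
  finally have "real_of_rat ((rat_of_int \<bar>\<lfloor>a / c\<rfloor>\<bar> - 1) * \<bar>c\<bar>) \<le> real_of_rat \<bar>a\<bar>"
    by (simp only: of_rat_less_eq)
  thus ?thesis by (simp add: of_rat_mult of_rat_diff flip: of_int_abs)
qed

text \<open>Let \<open>M\<close> be the larger bottom entry in absolute value. The entry above it is
  about \<open>n\<close> times as large, so the height is at least \<open>M\<close> and at least
  \<open>(|n| - 1) * M\<close>, hence at least half of \<open>M * max 1 |n|\<close>; cubing the half
  gives the 8.\<close>

lemma SL2Z_code_bound:
  assumes "A \<in> SL2Z"
  shows "1 / height A ^ 3 \<le> 8 * (case SL2Z_code A of (c, d, n) \<Rightarrow> decay c * (decay d * decay n))"
proof -
  define c where "c = \<lfloor>A $ 2 $ 1\<rfloor>"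
  define d where "d = \<lfloor>A $ 2 $ 2\<rfloor>"
  define n where "n = row_floor A"
  have int: "A $ i $ j \<in> \<int>" for i j using assms by (auto simp: SL2Z_def)
  have c: "A $ 2 $ 1 = of_int c" and d: "A $ 2 $ 2 = of_int d"
    unfolding c_def d_def using int[of 2 1] int[of 2 2] by (auto elim!: Ints_cases)
  have det: "A $ 1 $ 1 * of_int d - A $ 1 $ 2 * of_int c = 1"
    using assms by (simp add: SL2Z_def det_2 c d)
  define M where "M = max \<bar>c\<bar> \<bar>d\<bar>"
  \<comment> \<open>A vanishing bottom row would contradict determinant 1.\<close>
  have M1: "1 \<le> M" using det unfolding M_def by (cases "c = 0"; cases "d = 0") auto
  have hM: "real_of_int M \<le> height A"
    unfolding height_2 c d M_def by (simp add: max_def)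
  have hnM: "(\<bar>real_of_int n\<bar> - 1) * real_of_int M \<le> height A"
  proof (cases "\<bar>d\<bar> \<le> \<bar>c\<bar>")
    case True
    hence "A $ 2 $ 1 \<noteq> 0" using M1 by (auto simp: c M_def)
    moreover have "n = \<lfloor>A $ 1 $ 1 / A $ 2 $ 1\<rfloor>" unfolding n_def row_floor_def c d
      using True by (simp flip: of_int_abs)
    ultimately have "(\<bar>real_of_int n\<bar> - 1) * \<bar>real_of_rat (A $ 2 $ 1)\<bar> \<le> \<bar>real_of_rat (A $ 1 $ 1)\<bar>"
      using floor_div_bound by simp
    also have "\<bar>real_of_rat (A $ 2 $ 1)\<bar> = real_of_int M" using True by (simp add: c M_def)
    finally show ?thesis unfolding height_2 by linarith
  next
    case False
    hence "A $ 2 $ 2 \<noteq> 0" using M1 by (auto simp: d M_def)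
    moreover have "n = \<lfloor>A $ 1 $ 2 / A $ 2 $ 2\<rfloor>" unfolding n_def row_floor_def c d
      using False by (simp flip: of_int_abs)
    ultimately have "(\<bar>real_of_int n\<bar> - 1) * \<bar>real_of_rat (A $ 2 $ 2)\<bar> \<le> \<bar>real_of_rat (A $ 1 $ 2)\<bar>"
      using floor_div_bound by simp
    also have "\<bar>real_of_rat (A $ 2 $ 2)\<bar> = real_of_int M" using False by (simp add: d M_def)
    finally show ?thesis unfolding height_2 by linarith
  qed
  define N where "N = max 1 (real_of_int \<bar>n\<bar>)"
  have N1: "1 \<le> N" by (simp add: N_def)
  \<comment> \<open>For \<open>|n|\<close> up to 2 the factor \<open>N / 2\<close> is at most 1 and
    the first bound suffices; beyond that \<open>|n| - 1\<close> is at least \<open>N / 2\<close>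
    and the second one does.\<close>
  have MN: "real_of_int M * N / 2 \<le> height A"
  proof (cases "\<bar>n\<bar> \<le> 2")
    case True
    hence "N \<le> 2" by (simp add: N_def)
    hence "real_of_int M * N \<le> real_of_int M * 2" using M1 by (intro mult_left_mono) auto
    thus ?thesis using hM by simp
  next
    case False
    hence "2 < \<bar>real_of_int n\<bar>" by linarith
    hence "N / 2 \<le> \<bar>real_of_int n\<bar> - 1" by (simp add: N_def max_def)
    hence "N / 2 * real_of_int M \<le> (\<bar>real_of_int n\<bar> - 1) * real_of_int M"
      using M1 by (intro mult_right_mono) auto
    thus ?thesis using hnM by (simp add: mult.commute)
  qed
  have "1 / height A ^ 3 \<le> 1 / (real_of_int M * N / 2) ^ 3"
    using M1 N1 MN by (intro divide_left_mono power_mono mult_pos_pos zero_less_power) (auto intro!: less_le_trans[OF _ MN])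
  also have "\<dots> = 8 * (1 / real_of_int M ^ 3 * (1 / N ^ 3))"
    by (simp add: power_mult_distrib power_divide)
  also have "\<dots> \<le> 8 * ((decay c * decay d) * decay n)"
  proof (intro mult_left_mono mult_mono)
    show "1 / real_of_int M ^ 3 \<le> decay c * decay d"
      unfolding decay_def by (rule inverse_cube_le_powr) (use M1 in \<open>auto simp: M_def\<close>)
    \<comment> \<open>The inverse cube of \<open>M\<close> is shared by \<open>c\<close> and
      \<open>d\<close>, that of \<open>N\<close> serves \<open>n\<close> alone; it is weakened so
      that the same \<open>decay\<close> fits.\<close>
    have "1 / N ^ 3 = N powr (-3)"
      using N1 by (simp add: powr_minus_divide powr_numeral)
    also have "\<dots> \<le> N powr (-3/2)" using N1 by (intro powr_mono) auto
    finally show "1 / N ^ 3 \<le> decay n" by (simp add: decay_def N_def)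
  qed (use N1 in \<open>auto simp: decay_def\<close>)
  finally show ?thesis by (simp add: SL2Z_code_def c_def d_def n_def mult.assoc)
qed

lemma SL2Z_height_summable: "(\<lambda>A. 1 / height A ^ 3) summable_on SL2Z"
proof (rule summable_on_comparison_test)
  have "(\<lambda>(c, d, n). decay c * (decay d * decay n)) summable_on SL2Z_code ` SL2Z"
    by (rule summable_on_subset[OF decay_triple_summable]) auto
  hence "(\<lambda>A. case SL2Z_code A of (c, d, n) \<Rightarrow> decay c * (decay d * decay n)) summable_on SL2Z"
    by (subst (asm) summable_on_reindex[OF SL2Z_code_inj]) (simp add: o_def)
  thus "(\<lambda>A. 8 * (case SL2Z_code A of (c, d, n) \<Rightarrow> decay c * (decay d * decay n))) summable_on SL2Z"
    by (rule summable_on_cmult_right)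
qed (auto simp: SL2Z_code_bound height_nonneg)

section \<open>Commensurable groups\<close>

lemma group_SL2Q: "group SL2Q"
proof (rule groupI)
  fix A assume "A \<in> carrier SL2Q"
  hence d: "det A = 1" by (simp add: SL2Q_def)
  hence "invertible A" by (simp add: invertible_det_nz)
  then obtain B where B: "A ** B = mat 1" "B ** A = mat 1" by (auto simp: invertible_def)
  have "det A * det B = 1" using B(1) by (metis det_I det_mul)
  thus "\<exists>B\<in>carrier SL2Q. B \<otimes>\<^bsub>SL2Q\<^esub> A = \<one>\<^bsub>SL2Q\<^esub>" using B d by (auto simp: SL2Q_def)
qed (auto simp: SL2Q_def det_mul matrix_mul_assoc)

text \<open>Finitely many right cosets of \<open>\<Gamma> \<inter> SL2Z\<close> cover
  \<open>\<Gamma>\<close>. On the coset of \<open>g\<close>, writing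
  \<open>h = (h ** g) ** g'\<close> with \<open>g'\<close> inverse to \<open>g\<close> bounds the
  height of \<open>h\<close> by a constant times that of \<open>h ** g\<close>, so the sum over
  SL2(Z) is a majorant.\<close>

lemma commensurable_height_summable:
  assumes sub: "subgroup \<Gamma> SL2Q" and com: "commensurable SL2Q \<Gamma> SL2Z"
  shows "(\<lambda>A. 1 / height A ^ 3) summable_on \<Gamma>"
proof -
  define C where "C = rcosets\<^bsub>SL2Q\<lparr>carrier := \<Gamma>\<rparr>\<^esub> (\<Gamma> \<inter> SL2Z)"
  have fin: "finite C" using com by (simp add: commensurable_def C_def)
  have C_eq: "C = (\<lambda>g. (\<lambda>h. h ** g) ` (\<Gamma> \<inter> SL2Z)) ` \<Gamma>"
    by (auto simp: C_def RCOSETS_def r_coset_def SL2Q_def)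
  have dG: "det g = 1" if "g \<in> \<Gamma>" for g
    using subgroup.subset[OF sub] that by (auto simp: SL2Q_def)
  have one: "mat 1 \<in> \<Gamma> \<inter> SL2Z"
    using subgroup.one_closed[OF sub] by (auto simp: SL2Q_def SL2Z_def) (simp add: mat_def)
  have "\<Gamma> \<subseteq> \<Union>C"
  proof
    fix g assume "g \<in> \<Gamma>"
    moreover have "g \<in> (\<lambda>h. h ** g) ` (\<Gamma> \<inter> SL2Z)" by (rule image_eqI[OF _ one]) simp
    ultimately show "g \<in> \<Union>C" unfolding C_eq by blast
  qed
  moreover have coset: "(\<lambda>A. 1 / height A ^ 3) summable_on X" if "X \<in> C" for X
  proof -
    from that obtain g where g: "g \<in> \<Gamma>" and X: "X = (\<lambda>h. h ** g) ` (\<Gamma> \<inter> SL2Z)"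
      unfolding C_eq by auto
    have "invertible g" using dG[OF g] by (simp add: invertible_det_nz)
    then obtain g' where g': "g ** g' = mat 1" by (auto simp: invertible_def)
    have inj: "inj_on (\<lambda>h. h ** g) (\<Gamma> \<inter> SL2Z)"
      by (rule inj_on_inverseI[where g = "\<lambda>h. h ** g'"]) (simp flip: matrix_mul_assoc add: g')
    have "(\<lambda>h. 1 / height (h ** g) ^ 3) summable_on (\<Gamma> \<inter> SL2Z)"
    proof (rule summable_on_comparison_test)
      have "(\<lambda>h. 1 / height h ^ 3) summable_on (\<Gamma> \<inter> SL2Z)"
        by (rule summable_on_subset[OF SL2Z_height_summable]) auto
      thus "(\<lambda>h. height g' ^ 3 * (1 / height h ^ 3)) summable_on (\<Gamma> \<inter> SL2Z)"
        by (rule summable_on_cmult_right)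
      fix h assume h: "h \<in> \<Gamma> \<inter> SL2Z"
      have p: "0 < height h" "0 < height (h ** g)"
        using h g by (auto intro!: height_pos simp: dG det_mul)
      have "h = (h ** g) ** g'" by (simp flip: matrix_mul_assoc add: g')
      hence "height h \<le> height (h ** g) * height g'" by (metis height_mult)
      hence "height h ^ 3 \<le> (height (h ** g) * height g') ^ 3"
        using p by (intro power_mono) auto
      thus "1 / height (h ** g) ^ 3 \<le> height g' ^ 3 * (1 / height h ^ 3)"
        using p by (simp add: field_simps power_mult_distrib)
      show "0 \<le> 1 / height (h ** g) ^ 3" by (simp add: height_nonneg)
    qed
    thus ?thesis unfolding X by (subst summable_on_reindex[OF inj]) (simp add: o_def)
  qed
  have "(\<lambda>A. 1 / height A ^ 3) summable_on \<Union>D"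
    if "D \<subseteq> C" "finite D" for D using that(2,1)
    by (induction D rule: finite_induct) (auto intro: summable_on_union coset)
  ultimately show ?thesis using fin summable_on_subset by blast
qed

text \<open>Infinitely many matrices of height at most \<open>R\<close> would each contribute at
  least \<open>1 / R ^ 3\<close> to a convergent sum.\<close>

lemma height_ball_finite:
  assumes "(\<lambda>A. 1 / height A ^ 3) summable_on \<Gamma>" and "\<And>A. A \<in> \<Gamma> \<Longrightarrow> det A = 1"
  shows "finite {A \<in> \<Gamma>. height A \<le> R}"
proof (rule ccontr)
  let ?F = "{A \<in> \<Gamma>. height A \<le> R}"
  assume inf: "infinite ?F"
  then obtain A where "A \<in> ?F" by (metis finite.emptyI ex_in_conv)
  hence R: "R > 0" using height_pos assms(2) by fastforce
  have "(\<lambda>A. 1 / R ^ 3) summable_on ?F"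
  proof (rule summable_on_comparison_test)
    show "(\<lambda>A. 1 / height A ^ 3) summable_on ?F" by (rule summable_on_subset[OF assms(1)]) auto
    fix A assume A: "A \<in> ?F"
    hence "0 < height A" using assms(2) height_pos by auto
    thus "1 / R ^ 3 \<le> 1 / height A ^ 3" using A by (auto intro!: divide_left_mono power_mono mult_pos_pos simp: R)
  qed (use R in auto)
  thus False using inf R infsum_diverge_constant[of ?F "1 / R ^ 3"] by simp
qed

text \<open>Put \<alpha> = az + b and \<beta> = cz + d. Determinant 1 makes \<open>Im z\<close> the
  imaginary part of \<alpha> times the conjugate of \<beta>, and this yields a quadratic inequality
  for |\<beta>| with linear coefficient |\<alpha> - w\<beta>|. A small form thus forces small
  \<beta>, then small \<alpha>, then small entries. The bound involves \<open>z\<close> only through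
  the form itself and \<open>e\<close>, \<open>Y\<close>, \<open>Z\<close>, so it is uniform on a
  ball.\<close>

lemma matrix_entries_le_linear_form:
  fixes a b c d e Y Z :: real and z w :: complex
  assumes det: "a * d - b * c = 1" and e: "0 < e" "e \<le> \<bar>Im z\<bar>" and Y: "\<bar>Im z\<bar> \<le> Y"
    and Z: "norm z \<le> Z" and w: "Im w \<noteq> 0"
  shows "\<bar>a\<bar> + \<bar>b\<bar> + \<bar>c\<bar> + \<bar>d\<bar> \<le> (1 + (1 + Z) / e) *
    (norm ((a * z + b) - w * (c * z + d))
      + (norm w + 1) * (2 * norm ((a * z + b) - w * (c * z + d)) / \<bar>Im w\<bar> + (1 + 2 * Y / \<bar>Im w\<bar>)))"
proof -
  define \<alpha> where "\<alpha> = a * z + b"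
  define \<beta> where "\<beta> = c * z + d"
  define \<delta> where "\<delta> = norm (\<alpha> - w * \<beta>)"
  define v where "v = \<bar>Im w\<bar>"
  have v: "v > 0" using w by (simp add: v_def)
  \<comment> \<open>As \<open>z\<close> is off the real axis, the imaginary part recovers
    \<open>p\<close>, and subtracting \<open>p * z\<close> then recovers \<open>q\<close>.\<close>
  have row: "\<bar>p\<bar> + \<bar>q\<bar> \<le> (1 + (1 + Z) / e) * norm (p * z + q)" for p q :: real
  proof -
    have "\<bar>p\<bar> * e \<le> \<bar>p\<bar> * \<bar>Im z\<bar>" using e by (intro mult_left_mono) auto
    also have "\<dots> = \<bar>Im (p * z + q)\<bar>" by (simp add: abs_mult)
    also have "\<dots> \<le> norm (p * z + q)" by (rule abs_Im_le_cmod)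
    finally have p: "\<bar>p\<bar> \<le> norm (p * z + q) / e" using e by (simp add: field_simps)
    have "norm (complex_of_real q) \<le> norm (p * z + q) + norm (p * z)"
      by (metis add_diff_cancel_left' norm_triangle_ineq4)
    hence "\<bar>q\<bar> \<le> norm (p * z + q) + \<bar>p\<bar> * norm z" by (simp add: norm_mult)
    also have "\<bar>p\<bar> * norm z \<le> norm (p * z + q) / e * Z"
      using p Z e by (intro mult_mono) auto
    finally show ?thesis using p by (simp add: algebra_simps add_divide_distrib)
  qed
  have \<alpha>: "norm \<alpha> \<le> \<delta> + norm w * norm \<beta>"
    unfolding \<delta>_def by (metis norm_mult norm_triangle_sub add.commute)
  have im: "Im ((\<alpha> - w * \<beta>) * cnj \<beta>) + Im w * (norm \<beta>)\<^sup>2 = Im z"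
  proof -
    have "(\<alpha> - w * \<beta>) * cnj \<beta> + w * (\<beta> * cnj \<beta>) = \<alpha> * cnj \<beta>" by (simp add: algebra_simps)
    hence "Im ((\<alpha> - w * \<beta>) * cnj \<beta> + w * of_real ((norm \<beta>)\<^sup>2)) = Im (\<alpha> * cnj \<beta>)"
      by (simp only: complex_mult_cnj cmod_power2)
    moreover have "Im (\<alpha> * cnj \<beta>) = (a * d - b * c) * Im z"
      by (simp add: \<alpha>_def \<beta>_def algebra_simps)
    ultimately show ?thesis by (simp add: det)
  qed
  have "v * (norm \<beta>)\<^sup>2 = \<bar>Im w * (norm \<beta>)\<^sup>2\<bar>" by (simp add: v_def abs_mult)
  also have "\<dots> \<le> \<bar>Im z\<bar> + \<bar>Im ((\<alpha> - w * \<beta>) * cnj \<beta>)\<bar>" using im by linarith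
  also have "\<bar>Im ((\<alpha> - w * \<beta>) * cnj \<beta>)\<bar> \<le> \<delta> * norm \<beta>"
    using abs_Im_le_cmod[of "(\<alpha> - w * \<beta>) * cnj \<beta>"] by (simp add: norm_mult \<delta>_def)
  finally have quad: "v * (norm \<beta>)\<^sup>2 \<le> Y + \<delta> * norm \<beta>" using Y by linarith
  \<comment> \<open>If this failed, the summand 1 would force |\<beta>| > 1, and v|\<beta>| > Y +
    \<delta> would then give v|\<beta>|^2 > Y + \<delta>|\<beta>|, against
    \<open>quad\<close>.\<close>
  have \<beta>: "norm \<beta> \<le> 2 * \<delta> / v + (1 + 2 * Y / v)"
  proof (rule ccontr)
    assume "\<not> ?thesis"
    hence "2 * \<delta> / v + (1 + 2 * Y / v) < norm \<beta>" by simp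
    hence gt: "2 * \<delta> + v + 2 * Y < v * norm \<beta>" using v by (simp add: field_simps)
    have nn: "0 \<le> \<delta>" "0 \<le> Y" using Y by (auto simp: \<delta>_def)
    have b1: "1 < norm \<beta>"
    proof -
      have "v * 1 < v * norm \<beta>" using gt nn by linarith
      thus ?thesis using v by (simp only: mult_less_cancel_left_pos)
    qed
    have "Y + \<delta> * norm \<beta> \<le> (Y + \<delta>) * norm \<beta>"
      using b1 nn mult_left_mono[of 1 "norm \<beta>" Y] by (simp add: algebra_simps)
    also have "\<dots> < (v * norm \<beta>) * norm \<beta>"
      using gt nn v b1 by (intro mult_strict_right_mono) auto
    finally show False using quad by (simp add: power2_eq_square mult.assoc)
  qed
  have "\<bar>a\<bar> + \<bar>b\<bar> + \<bar>c\<bar> + \<bar>d\<bar> \<le> (1 + (1 + Z) / e) * (norm \<alpha> + norm \<beta>)"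
    using row[of a b] row[of c d] by (simp add: \<alpha>_def \<beta>_def distrib_left)
  also have "\<dots> \<le> (1 + (1 + Z) / e) * (\<delta> + (norm w + 1) * (2 * \<delta> / v + (1 + 2 * Y / v)))"
  proof (rule mult_left_mono)
    have "norm \<alpha> + norm \<beta> \<le> \<delta> + (norm w + 1) * norm \<beta>" using \<alpha> by (simp add: algebra_simps)
    also have "(norm w + 1) * norm \<beta> \<le> (norm w + 1) * (2 * \<delta> / v + (1 + 2 * Y / v))"
      using \<beta> by (intro mult_left_mono) auto
    finally show "norm \<alpha> + norm \<beta> \<le> \<delta> + (norm w + 1) * (2 * \<delta> / v + (1 + 2 * Y / v))" by simp
    have "0 \<le> Z" using Z norm_ge_zero order_trans by blast
    thus "0 \<le> 1 + (1 + Z) / e" using e by simp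
  qed
  finally show ?thesis by (simp add: \<delta>_def v_def \<alpha>_def \<beta>_def)
qed

text \<open>The form called f with index \<gamma> above; \<open>cnj w\<close> in place of
  \<open>w\<close> gives g. It is \<open>moebius \<gamma> z - w\<close> with the denominator
  \<open>jfac \<gamma> z\<close> cleared.\<close>

definition afac :: "rat^2^2 \<Rightarrow> complex \<Rightarrow> complex \<Rightarrow> complex" where
  "afac \<gamma> w z = (of_rat (\<gamma> $ 1 $ 1) * z + of_rat (\<gamma> $ 1 $ 2)) - w * jfac \<gamma> z"

lemma height_le_afac:
  assumes "z0 \<notin> \<real>" "w \<notin> \<real>"
  obtains K L where "0 < K"
    "\<And>\<gamma> z. det \<gamma> = 1 \<Longrightarrow> z \<in> cball z0 (\<bar>Im z0\<bar> / 2) \<Longrightarrow> height \<gamma> \<le> K * norm (afac \<gamma> w z) + L"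
    "\<And>\<gamma> z. det \<gamma> = 1 \<Longrightarrow> z \<in> cball z0 (\<bar>Im z0\<bar> / 2) \<Longrightarrow> height \<gamma> \<le> K * norm (afac \<gamma> (cnj w) z) + L"
proof -
  \<comment> \<open>On the closed ball of radius half of \<open>|Im z0|\<close>,
    \<open>|Im z|\<close> stays between \<open>e\<close> and \<open>3 * e\<close>, and the norm is
    at most \<open>norm z0 + e\<close>. The constants see \<open>w\<close> only through its norm and
    \<open>|Im w|\<close>, hence serve \<open>cnj w\<close> too.\<close>
  define e where "e = \<bar>Im z0\<bar> / 2"
  define Y where "Y = 3 * e"
  define Z where "Z = norm z0 + e"
  define C where "C = 1 + (1 + Z) / e"
  define K where "K = C * (1 + (norm w + 1) * 2 / \<bar>Im w\<bar>)"
  define L where "L = C * ((norm w + 1) * (1 + 2 * Y / \<bar>Im w\<bar>))"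
  have e: "e > 0" using assms(1) by (simp add: e_def complex_is_Real_iff)
  have w: "Im w \<noteq> 0" using assms(2) by (simp add: complex_is_Real_iff)
  have "0 < C" using e by (simp add: C_def Z_def add_pos_nonneg)
  hence K: "0 < K" unfolding K_def by (intro mult_pos_pos add_pos_nonneg) auto
  have bound: "height \<gamma> \<le> K * norm (afac \<gamma> u z) + L"
    if d: "det \<gamma> = 1" and z: "z \<in> cball z0 (\<bar>Im z0\<bar> / 2)" and u: "norm u = norm w" "\<bar>Im u\<bar> = \<bar>Im w\<bar>" for \<gamma> z u
  proof -
    let ?r = "\<lambda>i j. real_of_rat (\<gamma> $ i $ j)"
    have nz: "norm (z - z0) \<le> e" using z by (simp add: e_def dist_norm norm_minus_commute)
    hence "\<bar>Im z - Im z0\<bar> \<le> e" using abs_Im_le_cmod[of "z - z0"] by simp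
    hence imz: "e \<le> \<bar>Im z\<bar>" "\<bar>Im z\<bar> \<le> Y" unfolding Y_def e_def by linarith+
    have zZ: "norm z \<le> Z" using nz norm_triangle_sub[of z z0] by (simp add: Z_def)
    have det': "?r 1 1 * ?r 2 2 - ?r 1 2 * ?r 2 1 = 1"
      using d by (simp add: det_2 flip: of_rat_mult of_rat_diff)
    have af: "(of_real (?r 1 1) * z + of_real (?r 1 2)) - u * (of_real (?r 2 1) * z + of_real (?r 2 2)) = afac \<gamma> u z"
      by (simp add: afac_def jfac_def)
    have "height \<gamma> \<le> C * (norm (afac \<gamma> u z)
        + (norm u + 1) * (2 * norm (afac \<gamma> u z) / \<bar>Im u\<bar> + (1 + 2 * Y / \<bar>Im u\<bar>)))"
      using matrix_entries_le_linear_form[OF det' e imz zZ, of u] w u(2) unfolding af height_2 C_def by fastforce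
    also have "\<dots> = K * norm (afac \<gamma> u z) + L"
      unfolding u K_def L_def by (simp add: algebra_simps add_divide_distrib)
    finally show ?thesis .
  qed
  show ?thesis by (rule that[OF K]) (auto intro!: bound)
qed

section \<open>Summands as rational functions, and the local decomposition of the series\<close>

lemma jfac_nonzero:
  assumes "det \<gamma> = 1" "z \<notin> \<real>"
  shows "jfac \<gamma> z \<noteq> 0"
proof
  let ?r = "\<lambda>i j. real_of_rat (\<gamma> $ i $ j)"
  assume "jfac \<gamma> z = 0"
  hence j: "complex_of_real (?r 2 1) * z + complex_of_real (?r 2 2) = 0" by (simp add: jfac_def)
  hence "Im (complex_of_real (?r 2 1) * z + complex_of_real (?r 2 2)) = 0" by (simp only: zero_complex.sel)
  hence c: "\<gamma> $ 2 $ 1 = 0" using assms(2) by (simp add: complex_is_Real_iff)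
  hence "\<gamma> $ 2 $ 2 = 0" using j by simp
  with c assms(1) show False by (simp add: det_2)
qed

lemma afac_eq:
  assumes "det \<gamma> = 1" "z \<notin> \<real>"
  shows "afac \<gamma> w z = jfac \<gamma> z * (moebius \<gamma> z - w)"
  using jfac_nonzero[OF assms] by (simp add: afac_def moebius_def field_simps)

lemma Im_moebius:
  assumes "det \<gamma> = 1" "z \<notin> \<real>"
  shows "Im (moebius \<gamma> z) = Im z / (norm (jfac \<gamma> z))\<^sup>2"
proof -
  let ?r = "\<lambda>i j. real_of_rat (\<gamma> $ i $ j)"
  have d: "?r 1 1 * ?r 2 2 - ?r 1 2 * ?r 2 1 = 1"
    using assms by (simp add: det_2 flip: of_rat_mult of_rat_diff)
  have "moebius \<gamma> z = (of_real (?r 1 1) * z + of_real (?r 1 2)) / jfac \<gamma> z" by (simp add: moebius_def)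
  hence "Im (moebius \<gamma> z) = Im ((of_real (?r 1 1) * z + of_real (?r 1 2)) * cnj (jfac \<gamma> z)) / (norm (jfac \<gamma> z))\<^sup>2"
    by (simp only: complex_div_cnj[of _ "jfac \<gamma> z"]) (simp flip: of_real_power)
  also have "jfac \<gamma> z = of_real (?r 2 1) * z + of_real (?r 2 2)" by (simp add: jfac_def)
  hence "Im ((of_real (?r 1 1) * z + of_real (?r 1 2)) * cnj (jfac \<gamma> z)) = (?r 1 1 * ?r 2 2 - ?r 1 2 * ?r 2 1) * Im z"
    by (simp add: algebra_simps)
  finally show ?thesis by (simp add: d)
qed

definition psi_term :: "complex \<Rightarrow> nat \<Rightarrow> nat \<Rightarrow> rat^2^2 \<Rightarrow> complex \<Rightarrow> complex" where
  "psi_term w p q \<gamma> z = (w - cnj w) / (afac \<gamma> w z ^ (p + 1) * afac \<gamma> (cnj w) z ^ (q + 1))"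

text \<open>The weight splits as \<open>(p + 1) + (q + 1)\<close>: just enough automorphy factors to
  clear the denominators of \<open>moebius \<gamma> z - w\<close> and
  \<open>moebius \<gamma> z - cnj w\<close>.\<close>

lemma psi_moebius:
  assumes "det \<gamma> = 1" "z \<notin> \<real>"
  shows "psi p q (moebius \<gamma> z) w / jfac \<gamma> z ^ (p + q + 2) = psi_term w p q \<gamma> z"
proof -
  have "p + q + 2 = (p + 1) + (q + 1)" by simp
  hence "jfac \<gamma> z ^ (p + q + 2) = jfac \<gamma> z ^ (p + 1) * jfac \<gamma> z ^ (q + 1)" by (simp only: power_add)
  thus ?thesis
    by (simp only: psi_def psi_term_def afac_eq[OF assms] power_mult_distrib divide_divide_eq_left mult_ac)
qed

lemma psi_term_meromorphic: "psi_term w p q \<gamma> meromorphic_on A"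
  unfolding psi_term_def [abs_def] afac_def jfac_def
  by (intro meromorphic_intros)

lemma psi_term_holomorphic:
  assumes "\<And>z. z \<in> A \<Longrightarrow> afac \<gamma> w z \<noteq> 0" "\<And>z. z \<in> A \<Longrightarrow> afac \<gamma> (cnj w) z \<noteq> 0"
  shows "psi_term w p q \<gamma> holomorphic_on A"
  using assms unfolding psi_term_def [abs_def] afac_def jfac_def
  by (intro holomorphic_intros) auto

text \<open>Outside a height ball both linear forms are at least a fixed multiple of the height, so
  the tail is majorised by inverse cubes uniformly near \<open>z0\<close> and sums to a holomorphic
  function. The ball is chosen before \<open>p\<close> and \<open>q\<close>, so one finite
  \<open>F\<close> serves all coefficients.\<close>

lemma Psi_local:
  assumes sub: "subgroup \<Gamma> SL2Q" and com: "commensurable SL2Q \<Gamma> SL2Z"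
    and "k > 0" and w: "w \<notin> \<real>" and z0: "z0 \<notin> \<real>"
  obtains F r where "finite F" "F \<subseteq> \<Gamma>" "0 < r"
    "\<And>\<gamma>. \<gamma> \<in> \<Gamma> - F \<Longrightarrow> afac \<gamma> w z0 \<noteq> 0"
    "\<And>p q. p + q = k \<Longrightarrow> \<exists>H. H holomorphic_on ball z0 r \<and>
        (\<forall>z\<in>ball z0 r. Psi \<Gamma> p q z w = (\<Sum>\<gamma>\<in>F. psi_term w p q \<gamma> z) + H z)"
proof -
  have dG: "det \<gamma> = 1" if "\<gamma> \<in> \<Gamma>" for \<gamma>
    using subgroup.subset[OF sub] that by (auto simp: SL2Q_def)
  note summ = commensurable_height_summable[OF sub com]
  define r where "r = \<bar>Im z0\<bar> / 2"
  have r: "r > 0" using z0 by (simp add: r_def complex_is_Real_iff)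
  have nr: "z \<notin> \<real>" if "z \<in> cball z0 r" for z
  proof
    assume "z \<in> \<real>"
    hence "\<bar>Im z0\<bar> \<le> norm (z0 - z)" using abs_Im_le_cmod[of "z0 - z"] by (simp add: complex_is_Real_iff)
    thus False using that r by (simp add: dist_norm r_def)
  qed
  obtain K L where K: "0 < K"
    and b1: "\<And>\<gamma> z. det \<gamma> = 1 \<Longrightarrow> z \<in> cball z0 r \<Longrightarrow> height \<gamma> \<le> K * norm (afac \<gamma> w z) + L"
    and b2: "\<And>\<gamma> z. det \<gamma> = 1 \<Longrightarrow> z \<in> cball z0 r \<Longrightarrow> height \<gamma> \<le> K * norm (afac \<gamma> (cnj w) z) + L"
    using height_le_afac[OF z0 w] unfolding r_def by blast
  \<comment> \<open>Above \<open>2 * L\<close> the constant \<open>L\<close> takes at most half of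
    the height; above 1 the inverse power \<open>k + 2\<close>, with \<open>k > 0\<close>, is at
    most the inverse cube.\<close>
  define F where "F = {\<gamma> \<in> \<Gamma>. height \<gamma> \<le> max 1 (2 * L)}"
  have finF: "finite F" unfolding F_def by (rule height_ball_finite[OF summ dG])
  have lower: "height \<gamma> / (2 * K) \<le> norm (afac \<gamma> w z) \<and> height \<gamma> / (2 * K) \<le> norm (afac \<gamma> (cnj w) z)"
    if "\<gamma> \<in> \<Gamma> - F" "z \<in> cball z0 r" for \<gamma> z
  proof -
    have "2 * L < height \<gamma>" "det \<gamma> = 1" using that by (auto simp: F_def dG)
    with b1[of \<gamma> z] b2[of \<gamma> z] that(2) show ?thesis using K by (auto simp: field_simps)
  qed
  have h1: "1 < height \<gamma>" if "\<gamma> \<in> \<Gamma> - F" for \<gamma> using that by (auto simp: F_def)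
  have nz: "afac \<gamma> w z \<noteq> 0" "afac \<gamma> (cnj w) z \<noteq> 0" if "\<gamma> \<in> \<Gamma> - F" "z \<in> cball z0 r" for \<gamma> z
  proof -
    have "0 < height \<gamma> / (2 * K)" using h1[OF that(1)] K by simp
    with lower[OF that] show "afac \<gamma> w z \<noteq> 0" "afac \<gamma> (cnj w) z \<noteq> 0" by auto
  qed
  have main: "\<exists>H. H holomorphic_on ball z0 r \<and>
        (\<forall>z\<in>ball z0 r. Psi \<Gamma> p q z w = (\<Sum>\<gamma>\<in>F. psi_term w p q \<gamma> z) + H z)" if pq: "p + q = k" for p q
  proof -
    define C where "C = norm (w - cnj w) * (2 * K) ^ (k + 2)"
    define H where "H z = (\<Sum>\<^sub>\<infinity>\<gamma>\<in>\<Gamma> - F. psi_term w p q \<gamma> z)" for z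
    have le: "norm (psi_term w p q \<gamma> z) \<le> C * (1 / height \<gamma> ^ 3)"
      if \<gamma>: "\<gamma> \<in> \<Gamma> - F" and z: "z \<in> cball z0 r" for \<gamma> z
    proof -
      have pos: "0 < height \<gamma> / (2 * K)" using h1[OF \<gamma>] K by simp
      have "norm (psi_term w p q \<gamma> z) = norm (w - cnj w) / (norm (afac \<gamma> w z) ^ (p + 1) * norm (afac \<gamma> (cnj w) z) ^ (q + 1))"
        unfolding psi_term_def norm_divide norm_mult norm_power ..
      also have "\<dots> \<le> norm (w - cnj w) / ((height \<gamma> / (2 * K)) ^ (p + 1) * (height \<gamma> / (2 * K)) ^ (q + 1))"
        using lower[OF \<gamma> z] pos nz[OF \<gamma> z]
        by (intro divide_left_mono mult_mono power_mono mult_pos_pos zero_less_power zero_le_power)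
          (auto simp: less_imp_le)
      also have "(height \<gamma> / (2 * K)) ^ (p + 1) * (height \<gamma> / (2 * K)) ^ (q + 1) = (height \<gamma> / (2 * K)) ^ (k + 2)"
        using pq by (simp flip: power_add)
      also have "norm (w - cnj w) / (height \<gamma> / (2 * K)) ^ (k + 2) = C * (1 / height \<gamma> ^ (k + 2))"
        by (simp add: C_def power_divide)
      also have "\<dots> \<le> C * (1 / height \<gamma> ^ 3)"
        using h1[OF \<gamma>] K \<open>k > 0\<close> unfolding C_def
        by (intro mult_left_mono divide_left_mono power_increasing mult_pos_pos zero_less_power) auto
      finally show ?thesis .
    qed
    have Msum: "(\<lambda>\<gamma>. C * (1 / height \<gamma> ^ 3)) summable_on (\<Gamma> - F)"
      by (intro summable_on_cmult_right summable_on_subset[OF summ]) auto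
    \<comment> \<open>The Weierstrass test along the net of finite subsets; uniform convergence
      passes holomorphy from the partial sums to \<open>H\<close>.\<close>
    have ul: "uniform_limit (cball z0 r) (\<lambda>X z. \<Sum>\<gamma>\<in>X. psi_term w p q \<gamma> z) H (finite_subsets_at_top (\<Gamma> - F))"
      unfolding H_def using le Msum by (rule Weierstrass_m_test_general)
    have hol: "psi_term w p q \<gamma> holomorphic_on cball z0 r" if "\<gamma> \<in> \<Gamma> - F" for \<gamma>
      using nz[OF that] by (intro psi_term_holomorphic) auto
    have "\<forall>\<^sub>F X in finite_subsets_at_top (\<Gamma> - F).
        continuous_on (cball z0 r) (\<lambda>z. \<Sum>\<gamma>\<in>X. psi_term w p q \<gamma> z) \<and>
        (\<lambda>z. \<Sum>\<gamma>\<in>X. psi_term w p q \<gamma> z) holomorphic_on ball z0 r"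
    proof (rule eventually_finite_subsets_at_top_weakI)
      fix X assume "finite X" "X \<subseteq> \<Gamma> - F"
      hence "(\<lambda>z. \<Sum>\<gamma>\<in>X. psi_term w p q \<gamma> z) holomorphic_on cball z0 r"
        by (intro holomorphic_on_sum hol) auto
      thus "continuous_on (cball z0 r) (\<lambda>z. \<Sum>\<gamma>\<in>X. psi_term w p q \<gamma> z) \<and>
        (\<lambda>z. \<Sum>\<gamma>\<in>X. psi_term w p q \<gamma> z) holomorphic_on ball z0 r"
        using holomorphic_on_imp_continuous_on holomorphic_on_subset ball_subset_cball by blast
    qed
    from holomorphic_uniform_limit[OF this ul] have "H holomorphic_on ball z0 r"
      by (auto simp: finite_subsets_at_top_neq_bot)
    moreover have "Psi \<Gamma> p q z w = (\<Sum>\<gamma>\<in>F. psi_term w p q \<gamma> z) + H z" if z: "z \<in> ball z0 r" for z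
    proof -
      have zc: "z \<in> cball z0 r" using z by auto
      have "Psi \<Gamma> p q z w = (\<Sum>\<^sub>\<infinity>\<gamma>\<in>\<Gamma>. psi_term w p q \<gamma> z)"
        unfolding Psi_def by (intro infsum_cong psi_moebius dG nr zc)
      also have "\<dots> = (\<Sum>\<^sub>\<infinity>\<gamma>\<in>F \<union> (\<Gamma> - F). psi_term w p q \<gamma> z)"
        by (rule arg_cong[where f = "infsum _"]) (auto simp: F_def)
      also have "\<dots> = (\<Sum>\<gamma>\<in>F. psi_term w p q \<gamma> z) + H z"
      proof (subst infsum_Un_disjoint)
        have "(\<lambda>\<gamma>. norm (psi_term w p q \<gamma> z)) summable_on (\<Gamma> - F)"
          by (rule Infinite_Sum.abs_summable_on_comparison_test'[OF Msum]) (use le zc in auto)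
        thus "(\<lambda>\<gamma>. psi_term w p q \<gamma> z) summable_on (\<Gamma> - F)" by (rule abs_summable_summable)
      qed (use finF in \<open>auto simp: H_def\<close>)
      finally show ?thesis .
    qed
    ultimately show ?thesis by blast
  qed
  show ?thesis
    by (rule that[OF finF _ r _ main]) (use nz r in \<open>auto simp: F_def\<close>)
qed

section \<open>Polynomials in four indeterminates\<close>

lemma lookup_Const_mult [simp]:
  "Poly_Mapping.lookup (Const c * P) m = c * Poly_Mapping.lookup P m"
  unfolding Const_def mult_map_scale_conv_mult[symmetric] by (simp add: Poly_Mapping.map.rep_eq when_def)

lemma Const_0 [simp]: "Const 0 = 0" and Const_1 [simp]: "Const 1 = 1"
  by (simp_all add: Const_def)

lemma Const_add: "Const (a + b) = Const a + Const b"
  by (simp add: Const_def single_add)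

lemma Const_uminus: "Const (- a) = - Const a"
  by (simp add: Const_def single_uminus)

lemma Const_diff: "Const (a - b) = Const a - Const b"
  by (simp add: Const_def single_diff)

lemma Const_mult: "Const (a * b) = Const a * Const b"
  by (simp add: Const_def mult_single)

lemma Const_power: "Const (a ^ n) = Const a ^ n"
  by (induction n) (simp_all add: Const_mult)

lemma Const_of_nat: "Const (of_nat n) = of_nat n"
  by (simp add: Const_def)

lemma poly_monomial_sum:
  fixes P :: cpoly4
  shows "P = (\<Sum>m\<in>Poly_Mapping.keys P. Poly_Mapping.single m (Poly_Mapping.lookup P m))"
  by (rule poly_mapping_eqI)
     (simp add: lookup_sum lookup_single when_def in_keys_iff sum.delta)

lemma UNIV_indet: "(UNIV :: indet set) = {IX, IY, IU, IV}"
  using indet.exhaust by blast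

instance indet :: finite
  by standard (simp add: UNIV_indet)

text \<open>Monomials outside the support have coefficient 0 and absent indeterminates exponent 0,
  so the index sets may be enlarged; different polynomials can then be summed over a common
  set.\<close>

lemma poly_subst_superset:
  assumes "finite A" "Poly_Mapping.keys P \<subseteq> A"
  shows "poly_subst \<sigma> P = (\<Sum>m\<in>A. Const (Poly_Mapping.lookup P m) *
           (\<Prod>v\<in>UNIV. \<sigma> v ^ Poly_Mapping.lookup m v))"
proof -
  have "(\<Prod>v\<in>Poly_Mapping.keys m. \<sigma> v ^ Poly_Mapping.lookup m v)
      = (\<Prod>v\<in>UNIV. \<sigma> v ^ Poly_Mapping.lookup m v)" for m
    by (rule prod.mono_neutral_left) (auto simp: in_keys_iff)
  hence "poly_subst \<sigma> P = (\<Sum>m\<in>Poly_Mapping.keys P. Const (Poly_Mapping.lookup P m) *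
           (\<Prod>v\<in>UNIV. \<sigma> v ^ Poly_Mapping.lookup m v))"
    by (simp add: poly_subst_def)
  also have "\<dots> = (\<Sum>m\<in>A. Const (Poly_Mapping.lookup P m) *
           (\<Prod>v\<in>UNIV. \<sigma> v ^ Poly_Mapping.lookup m v))"
    using assms by (intro sum.mono_neutral_left) (auto simp: in_keys_iff)
  finally show ?thesis .
qed

lemma poly_subst_single:
  "poly_subst \<sigma> (Poly_Mapping.single m c) = Const c * (\<Prod>v\<in>UNIV. \<sigma> v ^ Poly_Mapping.lookup m v)"
  by (subst poly_subst_superset[of "{m}"]) auto

lemma poly_subst_0 [simp]: "poly_subst \<sigma> 0 = 0"
  by (simp add: poly_subst_def)

lemma poly_subst_add: "poly_subst \<sigma> (P + Q) = poly_subst \<sigma> P + poly_subst \<sigma> Q"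
proof -
  let ?A = "Poly_Mapping.keys P \<union> Poly_Mapping.keys Q"
  have "Poly_Mapping.keys (P + Q) \<subseteq> ?A" by (rule Poly_Mapping.keys_add)
  thus ?thesis
    by (subst (1 2 3) poly_subst_superset[of ?A])
       (auto simp: lookup_add Const_add distrib_right sum.distrib)
qed

lemma poly_subst_sum: "poly_subst \<sigma> (\<Sum>i\<in>I. P i) = (\<Sum>i\<in>I. poly_subst \<sigma> (P i))"
  by (induction I rule: infinite_finite_induct) (simp_all add: poly_subst_add)

text \<open>Expanding both factors reduces this to a product of two monomials, whose exponents
  add.\<close>

lemma poly_subst_mult: "poly_subst \<sigma> (P * Q) = poly_subst \<sigma> P * poly_subst \<sigma> Q"
proof -
  let ?s = Poly_Mapping.single and ?l = Poly_Mapping.lookup and ?k = Poly_Mapping.keys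
  have "P * Q = (\<Sum>m\<in>?k P. ?s m (?l P m)) * (\<Sum>n\<in>?k Q. ?s n (?l Q n))"
    using poly_monomial_sum by metis
  hence "poly_subst \<sigma> (P * Q)
      = (\<Sum>m\<in>?k P. \<Sum>n\<in>?k Q. poly_subst \<sigma> (?s m (?l P m)) * poly_subst \<sigma> (?s n (?l Q n)))"
    by (simp add: sum_product poly_subst_sum mult_single poly_subst_single lookup_add power_add
        prod.distrib Const_mult mult_ac)
  also have "\<dots> = poly_subst \<sigma> (\<Sum>m\<in>?k P. ?s m (?l P m)) * poly_subst \<sigma> (\<Sum>n\<in>?k Q. ?s n (?l Q n))"
    by (simp add: sum_product poly_subst_sum)
  also have "\<dots> = poly_subst \<sigma> P * poly_subst \<sigma> Q"
    using poly_monomial_sum by metis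
  finally show ?thesis .
qed

lemma poly_subst_Const [simp]: "poly_subst \<sigma> (Const c) = Const c"
  by (simp add: Const_def[of c] poly_subst_single)

lemma poly_subst_Indet [simp]: "poly_subst \<sigma> (Indet v) = \<sigma> v"
proof -
  have "(\<Prod>u\<in>UNIV. \<sigma> u ^ Poly_Mapping.lookup (Poly_Mapping.single v 1) u)
      = (\<Prod>u\<in>UNIV. if u = v then \<sigma> u else 1)"
    by (rule prod.cong) (auto simp: lookup_single)
  also have "\<dots> = \<sigma> v" by (simp add: prod.delta)
  finally show ?thesis by (simp add: Indet_def poly_subst_single)
qed

lemma poly_subst_power: "poly_subst \<sigma> (P ^ n) = poly_subst \<sigma> P ^ n"
  using poly_subst_Const[of \<sigma> 1] by (induction n) (simp_all add: poly_subst_mult)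

lemma poly_subst_diff: "poly_subst \<sigma> (P - Q) = poly_subst \<sigma> P - poly_subst \<sigma> Q"
proof -
  have "poly_subst \<sigma> ((P - Q) + Q) = poly_subst \<sigma> (P - Q) + poly_subst \<sigma> Q"
    by (rule poly_subst_add)
  thus ?thesis by simp
qed

lemmas poly_subst_simps = poly_subst_add poly_subst_mult poly_subst_power poly_subst_diff

section \<open>The form XV - YU under pairs of matrices\<close>

definition bracket :: "rat^2^2 \<Rightarrow> rat^2^2 \<Rightarrow> cpoly4" where
  "bracket \<gamma> \<delta> = lin_subst \<gamma> \<delta> IX * lin_subst \<gamma> \<delta> IV - lin_subst \<gamma> \<delta> IY * lin_subst \<gamma> \<delta> IU"

lemma slash_bracket_power:
  "slash ((Indet IX * Indet IV - Indet IY * Indet IU) ^ k) \<gamma> \<delta> = bracket \<gamma> \<delta> ^ k"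
  by (simp add: slash_def bracket_def poly_subst_simps)

text \<open>The substitution performed second appears on the right of the product; this is what
  makes \<open>slash\<close> a right action.\<close>

lemma poly_subst_lin_subst:
  "poly_subst (lin_subst \<gamma>' \<delta>') (lin_subst \<gamma> \<delta> v) = lin_subst (\<gamma> ** \<gamma>') (\<delta> ** \<delta>') v"
  by (cases v) (simp_all add: poly_subst_simps matrix_matrix_mult_def sum_2 of_rat_add of_rat_mult
      Const_add Const_mult algebra_simps)

lemma slash_bracket:
  "slash (bracket \<gamma> \<delta> ^ k) \<gamma>' \<delta>' = bracket (\<gamma> ** \<gamma>') (\<delta> ** \<delta>') ^ k"
  by (simp add: slash_def bracket_def poly_subst_simps poly_subst_lin_subst del: lin_subst.simps)

text \<open>The bracket is the 2x2 determinant whose columns are the transformed (X, Y) and (U, V);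
  multiplying both columns by \<open>\<delta>\<close> from the left multiplies it by
  \<open>det \<delta>\<close>.\<close>

lemma bracket_diagonal:
  assumes "det \<delta> = 1"
  shows "bracket (\<delta> ** \<gamma>) (\<delta> ** \<gamma>') = bracket \<gamma> \<gamma>'"
proof -
  let ?c = "\<lambda>i j. Const (of_rat (\<delta> $ i $ j))"
  have d: "?c 1 1 * ?c 2 2 - ?c 1 2 * ?c 2 1 = 1"
    using assms by (simp add: det_2 flip: Const_mult Const_diff of_rat_mult of_rat_diff)
  have X: "lin_subst (\<delta> ** \<gamma>) (\<delta> ** \<gamma>') IX = ?c 1 1 * lin_subst \<gamma> \<gamma>' IX + ?c 1 2 * lin_subst \<gamma> \<gamma>' IY"
    and Y: "lin_subst (\<delta> ** \<gamma>) (\<delta> ** \<gamma>') IY = ?c 2 1 * lin_subst \<gamma> \<gamma>' IX + ?c 2 2 * lin_subst \<gamma> \<gamma>' IY"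
    and U: "lin_subst (\<delta> ** \<gamma>) (\<delta> ** \<gamma>') IU = ?c 1 1 * lin_subst \<gamma> \<gamma>' IU + ?c 1 2 * lin_subst \<gamma> \<gamma>' IV"
    and V: "lin_subst (\<delta> ** \<gamma>) (\<delta> ** \<gamma>') IV = ?c 2 1 * lin_subst \<gamma> \<gamma>' IU + ?c 2 2 * lin_subst \<gamma> \<gamma>' IV"
    by (simp_all add: matrix_matrix_mult_def sum_2 of_rat_add of_rat_mult
      Const_add Const_mult algebra_simps)
  have "bracket (\<delta> ** \<gamma>) (\<delta> ** \<gamma>') = (?c 1 1 * ?c 2 2 - ?c 1 2 * ?c 2 1) * bracket \<gamma> \<gamma>'"
    unfolding bracket_def X Y U V by (simp only: algebra_simps)
  thus ?thesis by (simp add: d)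
qed

text \<open>Separating the two degrees of \<open>VkVk\<close> lets bidegrees add over products,
  starting from linear forms of bidegree (1, 0) and (0, 1).\<close>

definition bihomogeneous :: "nat \<Rightarrow> nat \<Rightarrow> cpoly4 set" where
  "bihomogeneous j k = {P. \<forall>m\<in>Poly_Mapping.keys P. Poly_Mapping.lookup P m \<in> \<rat> \<and>
                   Poly_Mapping.lookup m IX + Poly_Mapping.lookup m IY = j \<and>
                   Poly_Mapping.lookup m IU + Poly_Mapping.lookup m IV = k}"

lemma VkVk_eq_bihomogeneous: "VkVk k = bihomogeneous k k"
  by (simp add: VkVk_def bihomogeneous_def)

lemma bihomogeneous_add: "P \<in> bihomogeneous j k \<Longrightarrow> Q \<in> bihomogeneous j k \<Longrightarrow> P + Q \<in> bihomogeneous j k"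
  using Poly_Mapping.keys_add[of P Q]
  by (fastforce simp: bihomogeneous_def lookup_add in_keys_iff intro: Rats_add)

lemma bihomogeneous_uminus: "P \<in> bihomogeneous j k \<Longrightarrow> - P \<in> bihomogeneous j k"
  by (simp add: bihomogeneous_def)

lemma bihomogeneous_sum:
  "(\<And>i. i \<in> I \<Longrightarrow> P i \<in> bihomogeneous j k) \<Longrightarrow> (\<Sum>i\<in>I. P i) \<in> bihomogeneous j k"
  by (induction I rule: infinite_finite_induct)
     (auto intro: bihomogeneous_add, auto simp: bihomogeneous_def)

lemma bihomogeneous_mult:
  assumes P: "P \<in> bihomogeneous j k" and Q: "Q \<in> bihomogeneous j' k'"
  shows "P * Q \<in> bihomogeneous (j + j') (k + k')"
proof -
  let ?s = Poly_Mapping.single and ?l = Poly_Mapping.lookup and ?k = Poly_Mapping.keys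
  have "P * Q = (\<Sum>m\<in>?k P. ?s m (?l P m)) * (\<Sum>n\<in>?k Q. ?s n (?l Q n))"
    using poly_monomial_sum by metis
  also have "\<dots> = (\<Sum>m\<in>?k P. \<Sum>n\<in>?k Q. ?s (m + n) (?l P m * ?l Q n))"
    by (simp add: sum_product mult_single)
  also have "\<dots> \<in> bihomogeneous (j + j') (k + k')"
  proof (intro bihomogeneous_sum)
    fix m n assume mn: "m \<in> ?k P" "n \<in> ?k Q"
    thus "?s (m + n) (?l P m * ?l Q n) \<in> bihomogeneous (j + j') (k + k')"
      using P Q unfolding bihomogeneous_def
      by (auto simp: lookup_add intro!: Rats_mult split: if_splits)
  qed
  finally show ?thesis .
qed

lemma bihomogeneous_power: "P \<in> bihomogeneous j k \<Longrightarrow> P ^ n \<in> bihomogeneous (n * j) (n * k)"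
  by (induction n) (auto simp: bihomogeneous_mult, auto simp: bihomogeneous_def)

lemma bihomogeneous_lin_subst:
  "v \<in> {IX, IY} \<Longrightarrow> lin_subst \<gamma> \<delta> v \<in> bihomogeneous 1 0"
  "v \<in> {IU, IV} \<Longrightarrow> lin_subst \<gamma> \<delta> v \<in> bihomogeneous 0 1"
proof -
  have c: "Const (of_rat r) \<in> bihomogeneous 0 0" for r
    by (auto simp: bihomogeneous_def Const_def)
  have i: "Indet IX \<in> bihomogeneous 1 0" "Indet IY \<in> bihomogeneous 1 0"
    "Indet IU \<in> bihomogeneous 0 1" "Indet IV \<in> bihomogeneous 0 1"
    by (auto simp: bihomogeneous_def Indet_def lookup_single)
  have m: "Const (of_rat r) * P \<in> bihomogeneous j k" if "P \<in> bihomogeneous j k" for r P j k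
    using bihomogeneous_mult[OF c that] by simp
  show "v \<in> {IX, IY} \<Longrightarrow> lin_subst \<gamma> \<delta> v \<in> bihomogeneous 1 0"
    "v \<in> {IU, IV} \<Longrightarrow> lin_subst \<gamma> \<delta> v \<in> bihomogeneous 0 1"
    using i by (auto intro!: bihomogeneous_add m)
qed

lemma bracket_power_VkVk: "bracket \<gamma> \<delta> ^ k \<in> VkVk k"
proof -
  have "bracket \<gamma> \<delta> \<in> bihomogeneous 1 1"
    unfolding bracket_def diff_conv_add_uminus
    using bihomogeneous_mult[OF bihomogeneous_lin_subst(1) bihomogeneous_lin_subst(2)]
    by (intro bihomogeneous_add bihomogeneous_uminus) (auto simp del: lin_subst.simps)
  from bihomogeneous_power[OF this, of k] show ?thesis by (simp add: VkVk_eq_bihomogeneous)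
qed

section \<open>Residues of polynomial-valued functions\<close>

lemma meromorphic_at_holomorphic_punctured:
  assumes "f meromorphic_on {z}" "g meromorphic_on {z}"
  obtains r where "0 < r" "f holomorphic_on ball z r - {z}" "g holomorphic_on ball z r - {z}"
proof -
  from assms obtain r1 r2 where r: "0 < r1" "f analytic_on ball z r1 - {z}"
      "0 < r2" "g analytic_on ball z r2 - {z}"
    unfolding meromorphic_at_iff isolated_singularity_at_def by blast
  show ?thesis
  proof (rule that[of "min r1 r2"])
    show "f holomorphic_on ball z (min r1 r2) - {z}"
      by (rule analytic_imp_holomorphic, rule analytic_on_subset[OF r(2)]) auto
    show "g holomorphic_on ball z (min r1 r2) - {z}"
      by (rule analytic_imp_holomorphic, rule analytic_on_subset[OF r(4)]) auto
  qed (use r in auto)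
qed

lemma residue_meromorphic_add:
  assumes "f meromorphic_on {z}" "g meromorphic_on {z}"
  shows "residue (\<lambda>x. f x + g x) z = residue f z + residue g z"
proof -
  from meromorphic_at_holomorphic_punctured[OF assms] obtain r where
    "0 < r" "f holomorphic_on ball z r - {z}" "g holomorphic_on ball z r - {z}" by blast
  thus ?thesis by (intro residue_add[of "ball z r"]) auto
qed

lemma residue_meromorphic_rmul:
  assumes "f meromorphic_on {z}"
  shows "residue (\<lambda>x. f x * c) z = residue f z * c"
proof -
  from meromorphic_at_holomorphic_punctured[OF assms assms] obtain r where
    "0 < r" "f holomorphic_on ball z r - {z}" by blast
  thus ?thesis by (intro residue_rmul[of "ball z r"]) auto
qed

lemma residue_analytic:
  assumes "f analytic_on {z}"
  shows "residue f z = 0"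
proof -
  from assms obtain r where "0 < r" "f holomorphic_on ball z r"
    by (auto simp: analytic_on_def)
  thus ?thesis by (intro residue_holo[of "ball z r"]) auto
qed

text \<open>For \<open>i < j\<close> this is a pole of order at least 2 with constant numerator,
  whose derivatives vanish; for \<open>i > j\<close> the singularity is removable.\<close>

lemma residue_power_quotient:
  "residue (\<lambda>z. (z - w) ^ i / (z - w) ^ Suc j) w = (if i = j then 1 else 0)"
proof (cases i j rule: linorder_cases)
  case less
  have "residue (\<lambda>z. (z - w) ^ i / (z - w) ^ Suc j) w = residue (\<lambda>z. 1 / (z - w) ^ Suc (j - i)) w"
  proof (rule residue_cong)
    have "(z - w) ^ i / (z - w) ^ Suc j = 1 / (z - w) ^ Suc (j - i)" if "z \<noteq> w" for z
    proof -
      have "(z - w) ^ Suc j = (z - w) ^ i * (z - w) ^ Suc (j - i)"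
        using less by (simp flip: power_add power_Suc)
      thus ?thesis using that by simp
    qed
    thus "\<forall>\<^sub>F z in at w. (z - w) ^ i / (z - w) ^ Suc j = 1 / (z - w) ^ Suc (j - i)"
      by (auto simp: eventually_at_filter)
  qed simp
  also have "\<dots> = (deriv ^^ (j - i)) (\<lambda>_. 1) w / fact (j - i)"
    by (rule residue_holomorphic_over_power[of UNIV]) auto
  also have "\<dots> = 0" using less by (simp add: higher_deriv_const)
  finally show ?thesis using less by simp
next
  case equal
  have "residue (\<lambda>z. (z - w) ^ i / (z - w) ^ Suc j) w = residue (\<lambda>z. 1 / (z - w)) w"
    by (rule residue_cong) (auto simp: equal eventually_at_filter)
  also have "\<dots> = 1" by (rule residue_simple[of UNIV]) auto
  finally show ?thesis using equal by simp
next
  case greater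
  \<comment> \<open>For \<open>i = Suc j\<close> the two functions differ at \<open>w\<close>
    itself, with values 0 (division by zero) and 1; the residue sees only a punctured
    neighbourhood.\<close>
  have "residue (\<lambda>z. (z - w) ^ i / (z - w) ^ Suc j) w = residue (\<lambda>z. (z - w) ^ (i - Suc j)) w"
    by (rule residue_cong) (use greater in \<open>auto simp: eventually_at_filter power_diff\<close>)
  also have "\<dots> = 0" by (rule residue_holo[of UNIV]) (auto intro!: holomorphic_intros)
  finally show ?thesis using greater by simp
qed

text \<open>Naming the residue polynomial \<open>R\<close> in advance guarantees that the
  coefficient residues have finite support, as \<open>Abs_poly_mapping\<close> in
  \<open>poly_residue\<close> presupposes. Meromorphy is carried along because residues are added
  under that hypothesis.\<close>

definition has_poly_residue :: "(complex \<Rightarrow> cpoly4) \<Rightarrow> complex \<Rightarrow> cpoly4 \<Rightarrow> bool" where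
  "has_poly_residue F z R \<longleftrightarrow> (\<forall>m. (\<lambda>x. Poly_Mapping.lookup (F x) m) meromorphic_on {z} \<and>
      residue (\<lambda>x. Poly_Mapping.lookup (F x) m) z = Poly_Mapping.lookup R m)"

lemma has_poly_residue_imp_poly_residue: "has_poly_residue F z R \<Longrightarrow> poly_residue F z = R"
  by (simp add: has_poly_residue_def poly_residue_def Poly_Mapping.lookup_inverse)

lemma poly_meromorphic_onI:
  "(\<And>z. z \<in> S \<Longrightarrow> \<exists>R. has_poly_residue F z R) \<Longrightarrow> poly_meromorphic_on F S"
  unfolding poly_meromorphic_on_def has_poly_residue_def
  by (subst meromorphic_on_meromorphic_at) blast

lemma has_poly_residue_cong:
  assumes "\<forall>\<^sub>F x in at z. F x = G x" "has_poly_residue G z R"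
  shows "has_poly_residue F z R"
  unfolding has_poly_residue_def
proof (intro allI conjI)
  fix m
  have ev: "\<forall>\<^sub>F x in at z. Poly_Mapping.lookup (F x) m = Poly_Mapping.lookup (G x) m"
    using assms(1) by eventually_elim simp
  show "(\<lambda>x. Poly_Mapping.lookup (F x) m) meromorphic_on {z}"
    using assms(2) ev unfolding has_poly_residue_def
    by (subst meromorphic_on_cong[where g = "\<lambda>x. Poly_Mapping.lookup (G x) m"]) auto
  show "residue (\<lambda>x. Poly_Mapping.lookup (F x) m) z = Poly_Mapping.lookup R m"
    using assms(2) residue_cong[OF ev refl] unfolding has_poly_residue_def by simp
qed

lemma has_poly_residue_0: "has_poly_residue (\<lambda>_. 0) z 0"
  by (simp add: has_poly_residue_def residue_const meromorphic_on_const)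

lemma has_poly_residue_add:
  "has_poly_residue F z R \<Longrightarrow> has_poly_residue G z S \<Longrightarrow> has_poly_residue (\<lambda>x. F x + G x) z (R + S)"
  by (simp add: has_poly_residue_def lookup_add residue_meromorphic_add meromorphic_on_add)

lemma has_poly_residue_sum:
  "(\<And>i. i \<in> I \<Longrightarrow> has_poly_residue (F i) z (R i)) \<Longrightarrow> has_poly_residue (\<lambda>x. \<Sum>i\<in>I. F i x) z (\<Sum>i\<in>I. R i)"
  by (induction I rule: infinite_finite_induct) (simp_all add: has_poly_residue_0 has_poly_residue_add)

lemma has_poly_residue_Const:
  "h meromorphic_on {z} \<Longrightarrow> has_poly_residue (\<lambda>x. Const (h x) * Q) z (Const (residue h z) * Q)"
  by (simp add: has_poly_residue_def residue_meromorphic_rmul meromorphic_on_mult meromorphic_on_const)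

text \<open>The sign is kept apart so that \<open>z\<close> enters through a bare power; used for
  \<open>z\<close> itself and, when expanding about \<open>w\<close>, for
  \<open>z - w\<close>.\<close>

lemma linear_form_power:
  "(X - Const z * Y) ^ k = (\<Sum>j\<le>k. Const (of_nat (k choose j) * (-1) ^ (k - j) * z ^ (k - j)) * (X ^ j * Y ^ (k - j)))"
proof -
  have "(X - Const z * Y) ^ k = (X + Const (- z) * Y) ^ k" by (simp add: Const_uminus)
  also have "\<dots> = (\<Sum>j\<le>k. of_nat (k choose j) * X ^ j * (Const (- z) * Y) ^ (k - j))"
    by (rule binomial_ring)
  also have "\<dots> = (\<Sum>j\<le>k. Const (of_nat (k choose j) * (- z) ^ (k - j)) * (X ^ j * Y ^ (k - j)))"
    by (simp add: Const_mult Const_power Const_of_nat power_mult_distrib mult_ac)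
  also have "\<dots> = (\<Sum>j\<le>k. Const (of_nat (k choose j) * (-1) ^ (k - j) * z ^ (k - j)) * (X ^ j * Y ^ (k - j)))"
    by (simp add: power_minus[of z] mult_ac)
  finally show ?thesis .
qed

text \<open>Expanding the power leaves finitely many scalar functions, each \<open>h\<close> times a
  polynomial in \<open>z\<close>, in front of fixed polynomials; meromorphy and analyticity pass
  from \<open>h\<close> to them.\<close>

lemma has_poly_residue_linear_form:
  assumes "h meromorphic_on {z0}"
  shows "\<exists>R. has_poly_residue (\<lambda>z. Const (h z) * Q * (X - Const z * Y) ^ k) z0 R"
    and "h analytic_on {z0} \<Longrightarrow> has_poly_residue (\<lambda>z. Const (h z) * Q * (X - Const z * Y) ^ k) z0 0"
proof -
  define c where "c j z = h z * (of_nat (k choose j) * (-1) ^ (k - j) * z ^ (k - j))" for j z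
  have eq: "Const (h z) * Q * (X - Const z * Y) ^ k = (\<Sum>j\<le>k. Const (c j z) * (Q * (X ^ j * Y ^ (k - j))))" for z
    unfolding linear_form_power c_def by (simp add: sum_distrib_left Const_mult mult_ac)
  have mer: "c j meromorphic_on {z0}" for j
    unfolding c_def [abs_def] by (intro meromorphic_intros assms)
  have *: "has_poly_residue (\<lambda>z. Const (h z) * Q * (X - Const z * Y) ^ k) z0
      (\<Sum>j\<le>k. Const (residue (c j) z0) * (Q * (X ^ j * Y ^ (k - j))))"
    unfolding eq by (intro has_poly_residue_sum has_poly_residue_Const mer)
  thus "\<exists>R. has_poly_residue (\<lambda>z. Const (h z) * Q * (X - Const z * Y) ^ k) z0 R" by blast
  assume h: "h analytic_on {z0}"
  have "c j analytic_on {z0}" for j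
    unfolding c_def [abs_def] by (intro analytic_intros h)
  hence "residue (c j) z0 = 0" for j by (rule residue_analytic)
  with * show "has_poly_residue (\<lambda>z. Const (h z) * Q * (X - Const z * Y) ^ k) z0 0" by simp
qed

text \<open>Multiplied by \<open>E\<close>, both sides telescope to
  \<open>a ^ Suc k - b ^ Suc k\<close>. As \<open>E\<close> may be a zero divisor, the proof goes by
  induction on \<open>k\<close> instead, splitting off the term \<open>y ^ Suc k\<close>.\<close>

lemma complete_homogeneous_split:
  fixes a b V E \<alpha> \<beta> :: "'a::comm_ring_1"
  assumes a: "a - V = \<alpha> * E" and b: "b - V = \<beta> * E"
  shows "(\<alpha> - \<beta>) * (\<Sum>i\<le>k. a ^ i * b ^ (k - i))
    = \<alpha> * (\<Sum>i\<le>k. a ^ i * V ^ (k - i)) - \<beta> * (\<Sum>i\<le>k. b ^ i * V ^ (k - i))"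
proof (induction k)
  case 0
  show ?case by (simp add: algebra_simps)
next
  case (Suc k)
  define h where "h k x y = (\<Sum>i\<le>k. x ^ i * y ^ (k - i))" for k and x y :: 'a
  have step: "h (Suc k) x y = x * h k x y + y ^ Suc k" for x y
    unfolding h_def by (subst sum.atMost_Suc_shift) (simp add: sum_distrib_left mult_ac add.commute)
  have tel: "(b - V) * h k b V = b ^ Suc k - V ^ Suc k"
    unfolding h_def using diff_power_eq_sum[of b k V] by (simp add: lessThan_Suc_atMost)
  have IH: "(\<alpha> - \<beta>) * h k a b = \<alpha> * h k a V - \<beta> * h k b V" using Suc by (simp add: h_def)
  have ab: "a - b = (\<alpha> - \<beta>) * E"
    using arg_cong2[OF a b, of "(-)"] by (simp add: left_diff_distrib)
  have "(\<alpha> - \<beta>) * h (Suc k) a b = a * ((\<alpha> - \<beta>) * h k a b) + (\<alpha> - \<beta>) * b ^ Suc k"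
    unfolding step by (simp only: algebra_simps)
  also have "\<dots> = \<alpha> * h (Suc k) a V - \<beta> * h (Suc k) b V
      + ((\<alpha> - \<beta>) * (b ^ Suc k - V ^ Suc k) - (a - b) * (\<beta> * h k b V))"
    unfolding step IH by (simp only: algebra_simps)
  \<comment> \<open>The correction terms cancel: both equal (\<alpha> - \<beta>)\<beta>E times
    \<open>h k b V\<close>.\<close>
  also have "(\<alpha> - \<beta>) * (b ^ Suc k - V ^ Suc k) = (a - b) * (\<beta> * h k b V)"
    unfolding tel[symmetric] b ab by (simp only: mult_ac)
  finally have "(\<alpha> - \<beta>) * h (Suc k) a b = \<alpha> * h (Suc k) a V - \<beta> * h (Suc k) b V" by simp
  thus ?case by (simp add: h_def)
qed

lemma sum_pairs_eq: "(\<Sum>(p, q)\<in>{(p, q). p + q = k}. f p q) = (\<Sum>p\<le>k. f p (k - p))" for k :: nat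
  by (rule sum.reindex_bij_witness[of _ "\<lambda>p. (p, k - p)" fst]) auto

text \<open>The four letters are arbitrary polynomials, so that a stabilising matrix can be treated
  by replacing \<open>U\<close> and \<open>V\<close>.\<close>

lemma identity_summand_residue:
  fixes X Y U V :: cpoly4
  assumes w: "w \<notin> \<real>"
  shows "has_poly_residue (\<lambda>z. (\<Sum>p\<le>k. Const ((w - cnj w) / ((z - w) ^ (p + 1) * (z - cnj w) ^ (k - p + 1)))
      * (U - Const w * V) ^ p * (U - Const (cnj w) * V) ^ (k - p)) * (X - Const z * Y) ^ k) w ((X * V - Y * U) ^ k)"
proof -
  have ww: "w \<noteq> cnj w" using w by (metis Reals_cnj_iff)
  define A where "A = U - Const w * V"
  define B where "B = U - Const (cnj w) * V"
  \<comment> \<open>The split form: the first sum has poles only at \<open>w\<close>, the second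
    only at \<open>cnj w\<close>.\<close>
  define G where "G = (\<lambda>z. (\<Sum>i\<le>k. Const (1 / (z - w) ^ Suc i) * (A ^ i * V ^ (k - i)) * (X - Const z * Y) ^ k)
     + (\<Sum>i\<le>k. Const (- (1 / (z - cnj w) ^ Suc i)) * (B ^ i * V ^ (k - i)) * (X - Const z * Y) ^ k))"
  have expand: "(\<Sum>p\<le>k. Const ((w - cnj w) / ((z - w) ^ (p + 1) * (z - cnj w) ^ (k - p + 1)))
      * A ^ p * B ^ (k - p)) * (X - Const z * Y) ^ k = G z" if z: "z \<noteq> w" "z \<noteq> cnj w" for z
  proof -
    define \<alpha> where "\<alpha> = Const (1 / (z - w))"
    define \<beta> where "\<beta> = Const (1 / (z - cnj w))"
    have \<alpha>: "\<alpha> * Const (z - w) = 1" and \<beta>: "\<beta> * Const (z - cnj w) = 1"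
      using z by (simp_all add: \<alpha>_def \<beta>_def flip: Const_mult)
    have \<alpha>\<beta>: "\<alpha> - \<beta> = Const ((w - cnj w) / ((z - w) * (z - cnj w)))"
      unfolding \<alpha>_def \<beta>_def Const_diff[symmetric] using z by (simp add: field_simps)
    have a: "\<alpha> * A - V = \<alpha> * (U - Const z * V)"
    proof -
      have "\<alpha> * A - V = \<alpha> * A - (\<alpha> * Const (z - w)) * V" by (simp add: \<alpha>)
      also have "\<dots> = \<alpha> * (U - Const z * V)" unfolding A_def Const_diff by (simp only: algebra_simps)
      finally show ?thesis .
    qed
    have b: "\<beta> * B - V = \<beta> * (U - Const z * V)"
    proof -
      have "\<beta> * B - V = \<beta> * B - (\<beta> * Const (z - cnj w)) * V" by (simp add: \<beta>)
      also have "\<dots> = \<beta> * (U - Const z * V)" unfolding B_def Const_diff by (simp only: algebra_simps)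
      finally show ?thesis .
    qed
    have ap: "\<alpha> ^ i = Const (1 / (z - w) ^ i)" and bp: "\<beta> ^ i = Const (1 / (z - cnj w) ^ i)" for i
      by (simp_all add: \<alpha>_def \<beta>_def power_one_over flip: Const_power)
    have "(\<Sum>p\<le>k. Const ((w - cnj w) / ((z - w) ^ (p + 1) * (z - cnj w) ^ (k - p + 1))) * A ^ p * B ^ (k - p))
        = (\<alpha> - \<beta>) * (\<Sum>p\<le>k. (\<alpha> * A) ^ p * (\<beta> * B) ^ (k - p))"
      unfolding sum_distrib_left
    proof (rule sum.cong)
      fix p
      have "Const ((w - cnj w) / ((z - w) ^ (p + 1) * (z - cnj w) ^ (k - p + 1))) = (\<alpha> - \<beta>) * \<alpha> ^ p * \<beta> ^ (k - p)"
        unfolding \<alpha>\<beta> ap bp Const_mult[symmetric] by (simp add: mult_ac)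
      thus "Const ((w - cnj w) / ((z - w) ^ (p + 1) * (z - cnj w) ^ (k - p + 1))) * A ^ p * B ^ (k - p)
          = (\<alpha> - \<beta>) * ((\<alpha> * A) ^ p * (\<beta> * B) ^ (k - p))"
        by (simp only: power_mult_distrib mult_ac)
    qed simp
    also have "\<dots> = \<alpha> * (\<Sum>i\<le>k. (\<alpha> * A) ^ i * V ^ (k - i)) - \<beta> * (\<Sum>i\<le>k. (\<beta> * B) ^ i * V ^ (k - i))"
      by (rule complete_homogeneous_split[OF a b])
    also have "\<alpha> * (\<Sum>i\<le>k. (\<alpha> * A) ^ i * V ^ (k - i)) = (\<Sum>i\<le>k. \<alpha> ^ Suc i * (A ^ i * V ^ (k - i)))"
      by (simp add: sum_distrib_left power_mult_distrib mult_ac)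
    also have "\<beta> * (\<Sum>i\<le>k. (\<beta> * B) ^ i * V ^ (k - i)) = (\<Sum>i\<le>k. \<beta> ^ Suc i * (B ^ i * V ^ (k - i)))"
      by (simp add: sum_distrib_left power_mult_distrib mult_ac)
    finally show ?thesis unfolding ap bp G_def
      by (simp only: Const_uminus sum_distrib_right left_diff_distrib mult_minus_left sum_negf) simp
  qed
  have second: "has_poly_residue (\<lambda>z. \<Sum>i\<le>k. Const (- (1 / (z - cnj w) ^ Suc i)) * (B ^ i * V ^ (k - i)) * (X - Const z * Y) ^ k) w (\<Sum>i\<le>k. 0)"
  proof (intro has_poly_residue_sum has_poly_residue_linear_form(2))
    fix i
    show "(\<lambda>z. - (1 / (z - cnj w) ^ Suc i)) meromorphic_on {w}" by (intro meromorphic_intros)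
    show "(\<lambda>z. - (1 / (z - cnj w) ^ Suc i)) analytic_on {w}"
      using ww by (intro analytic_intros) auto
  qed
  \<comment> \<open>Expanding \<open>X - Const z * Y\<close> about \<open>w\<close> separates the
    powers of \<open>z - w\<close>, with scalars \<open>e j\<close>, from the fixed polynomials
    \<open>T i j\<close>.\<close>
  define T where "T i j = A ^ i * V ^ (k - i) * ((X - Const w * Y) ^ j * Y ^ (k - j))" for i j
  define e where "e j = of_nat (k choose j) * (-1 :: complex) ^ (k - j)" for j
  have first_eq: "Const (1 / (z - w) ^ Suc i) * (A ^ i * V ^ (k - i)) * (X - Const z * Y) ^ k
      = (\<Sum>j\<le>k. Const ((z - w) ^ (k - j) / (z - w) ^ Suc i * e j) * T i j)" for z i
  proof -
    have "X - Const z * Y = (X - Const w * Y) - Const (z - w) * Y" by (simp add: Const_diff algebra_simps)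
    hence "(X - Const z * Y) ^ k = (\<Sum>j\<le>k. Const (e j * (z - w) ^ (k - j)) * ((X - Const w * Y) ^ j * Y ^ (k - j)))"
      by (simp only: linear_form_power e_def)
    hence "Const (1 / (z - w) ^ Suc i) * (A ^ i * V ^ (k - i)) * (X - Const z * Y) ^ k
       = (\<Sum>j\<le>k. (Const (1 / (z - w) ^ Suc i) * Const (e j * (z - w) ^ (k - j))) * T i j)"
      by (simp only: sum_distrib_left T_def mult_ac)
    also have "\<dots> = (\<Sum>j\<le>k. Const ((z - w) ^ (k - j) / (z - w) ^ Suc i * e j) * T i j)"
      by (simp only: Const_mult[symmetric]) (simp add: mult_ac)
    finally show ?thesis .
  qed
  have first: "has_poly_residue (\<lambda>z. \<Sum>i\<le>k. Const (1 / (z - w) ^ Suc i) * (A ^ i * V ^ (k - i)) * (X - Const z * Y) ^ k) w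
      (\<Sum>i\<le>k. \<Sum>j\<le>k. Const ((if k - j = i then 1 else 0) * e j) * T i j)"
    unfolding first_eq
  proof (intro has_poly_residue_sum)
    fix i j
    have m: "(\<lambda>z. (z - w) ^ (k - j) / (z - w) ^ Suc i) meromorphic_on {w}" by (intro meromorphic_intros)
    have "residue (\<lambda>z. (z - w) ^ (k - j) / (z - w) ^ Suc i * e j) w = (if k - j = i then 1 else 0) * e j"
      by (simp only: residue_meromorphic_rmul[OF m] residue_power_quotient)
    moreover have "(\<lambda>z. (z - w) ^ (k - j) / (z - w) ^ Suc i * e j) meromorphic_on {w}" by (intro meromorphic_intros)
    ultimately show "has_poly_residue (\<lambda>z. Const ((z - w) ^ (k - j) / (z - w) ^ Suc i * e j) * T i j) w
        (Const ((if k - j = i then 1 else 0) * e j) * T i j)"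
      using has_poly_residue_Const[of "\<lambda>z. (z - w) ^ (k - j) / (z - w) ^ Suc i * e j" w "T i j"] by simp
  qed
  \<comment> \<open>Only pairs with \<open>i + j = k\<close> survive, where the exponent of
    \<open>z - w\<close> is -1; the binomial theorem then reassembles the single sum.\<close>
  have "(\<Sum>i\<le>k. \<Sum>j\<le>k. Const ((if k - j = i then 1 else 0) * e j) * T i j)
      = (\<Sum>j\<le>k. \<Sum>i\<le>k. if k - j = i then Const (e j) * T i j else 0)"
    by (subst sum.swap, intro sum.cong) auto
  also have "\<dots> = (\<Sum>j\<le>k. Const (e j) * T (k - j) j)"
    by (intro sum.cong refl) (simp add: sum.delta')
  also have "\<dots> = (\<Sum>j\<le>k. of_nat (k choose j) * (V * (X - Const w * Y)) ^ j * (- (A * Y)) ^ (k - j))"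
  proof (intro sum.cong refl)
    fix j assume "j \<in> {..k}"
    hence "k - (k - j) = j" by simp
    moreover have "Const (e j) = of_nat (k choose j) * (-1) ^ (k - j)"
      unfolding e_def Const_mult Const_of_nat Const_power Const_uminus by simp
    ultimately show "Const (e j) * T (k - j) j = of_nat (k choose j) * (V * (X - Const w * Y)) ^ j * (- (A * Y)) ^ (k - j)"
      unfolding T_def power_minus[of "A * Y"] by (simp only: power_mult_distrib mult_ac)
  qed
  also have "\<dots> = (V * (X - Const w * Y) + - (A * Y)) ^ k" by (rule binomial_ring[symmetric])
  also have "V * (X - Const w * Y) + - (A * Y) = X * V - Y * U" by (simp add: A_def algebra_simps)
  finally have "has_poly_residue G w ((X * V - Y * U) ^ k)"
    using has_poly_residue_add[OF first second] by (simp add: G_def)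
  moreover have "\<forall>\<^sub>F z in at w. z \<noteq> w \<and> z \<noteq> cnj w"
    by (intro eventually_conj eventually_neq_at_within)
  hence "\<forall>\<^sub>F z in at w. (\<Sum>p\<le>k. Const ((w - cnj w) / ((z - w) ^ (p + 1) * (z - cnj w) ^ (k - p + 1)))
      * A ^ p * B ^ (k - p)) * (X - Const z * Y) ^ k = G z"
    by eventually_elim (use expand in auto)
  ultimately show ?thesis unfolding A_def B_def by (rule has_poly_residue_cong[rotated])
qed

section \<open>The stabiliser and its contribution\<close>

lemma moebius_mult:
  assumes "det \<gamma> = 1" "det \<delta> = 1" "z \<notin> \<real>"
  shows "moebius (\<gamma> ** \<delta>) z = moebius \<gamma> (moebius \<delta> z)"
proof -
  let ?g = "\<lambda>i j. complex_of_rat (\<gamma> $ i $ j)" and ?d = "\<lambda>i j. complex_of_rat (\<delta> $ i $ j)"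
  define j where "j = jfac \<delta> z"
  have j: "j \<noteq> 0" using jfac_nonzero[OF assms(2,3)] by (simp add: j_def)
  define n where "n = ?d 1 1 * z + ?d 1 2"
  have m: "moebius \<delta> z = n / j" by (simp add: moebius_def n_def j_def)
  have "moebius (\<gamma> ** \<delta>) z = (?g 1 1 * n + ?g 1 2 * j) / (?g 2 1 * n + ?g 2 2 * j)"
    unfolding moebius_def jfac_def n_def j_def
    by (simp add: matrix_matrix_mult_def sum_2 of_rat_add of_rat_mult algebra_simps)
  also have "?g 1 1 * n + ?g 1 2 * j = j * (?g 1 1 * (n / j) + ?g 1 2)" using j by (simp add: field_simps)
  also have "?g 2 1 * n + ?g 2 2 * j = j * (?g 2 1 * (n / j) + ?g 2 2)" using j by (simp add: field_simps)
  also have "j * (?g 1 1 * (n / j) + ?g 1 2) / (j * (?g 2 1 * (n / j) + ?g 2 2)) = moebius \<gamma> (n / j)"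
    using j by (simp add: moebius_def jfac_def)
  finally show ?thesis by (simp add: m)
qed

lemma moebius_one [simp]: "moebius (mat 1) z = z"
  by (simp add: moebius_def jfac_def mat_def)

lemma subgroup_det:
  assumes "subgroup \<Gamma> SL2Q" "\<gamma> \<in> \<Gamma>"
  shows "det \<gamma> = 1"
  using subgroup.subset[OF assms(1)] assms(2) by (auto simp: SL2Q_def)

lemma SL2Q_simps [simp]: "x \<otimes>\<^bsub>SL2Q\<^esub> y = x ** y" "\<one>\<^bsub>SL2Q\<^esub> = mat 1"
  by (simp_all add: SL2Q_def)

lemma SL2Q_inv:
  assumes "subgroup \<Gamma> SL2Q" "\<gamma> \<in> \<Gamma>"
  shows "inv\<^bsub>SL2Q\<^esub> \<gamma> \<in> \<Gamma>" "inv\<^bsub>SL2Q\<^esub> \<gamma> ** \<gamma> = mat 1" "\<gamma> ** inv\<^bsub>SL2Q\<^esub> \<gamma> = mat 1"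
    "inv\<^bsub>SL2Q\<^esub> (inv\<^bsub>SL2Q\<^esub> \<gamma>) = \<gamma>"
proof -
  interpret group SL2Q by (rule group_SL2Q)
  have g: "\<gamma> \<in> carrier SL2Q" using subgroup.subset[OF assms(1)] assms(2) by auto
  show "inv\<^bsub>SL2Q\<^esub> \<gamma> \<in> \<Gamma>" using assms by (rule subgroup.m_inv_closed)
  show "inv\<^bsub>SL2Q\<^esub> \<gamma> ** \<gamma> = mat 1" using l_inv[OF g] by simp
  show "\<gamma> ** inv\<^bsub>SL2Q\<^esub> \<gamma> = mat 1" using r_inv[OF g] by simp
  show "inv\<^bsub>SL2Q\<^esub> (inv\<^bsub>SL2Q\<^esub> \<gamma>) = \<gamma>" using g by simp
qed

lemma stab_subgroup:
  assumes "subgroup \<Gamma> SL2Q" "w \<notin> \<real>"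
  shows "subgroup (stab \<Gamma> w) SL2Q"
proof (rule group.subgroupI[OF group_SL2Q])
  show "stab \<Gamma> w \<subseteq> carrier SL2Q" using subgroup.subset[OF assms(1)] by (auto simp: stab_def)
  show "stab \<Gamma> w \<noteq> {}" using subgroup.one_closed[OF assms(1)] by (auto simp: stab_def)
  fix a assume a: "a \<in> stab \<Gamma> w"
  hence aG: "a \<in> \<Gamma>" and aw: "moebius a w = w" by (auto simp: stab_def)
  note I = SL2Q_inv[OF assms(1) aG]
  have "moebius (inv\<^bsub>SL2Q\<^esub> a ** a) w = moebius (inv\<^bsub>SL2Q\<^esub> a) (moebius a w)"
    by (intro moebius_mult subgroup_det[OF assms(1)] I aG assms(2))
  hence "moebius (inv\<^bsub>SL2Q\<^esub> a) w = w" by (simp only: I aw moebius_one)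
  thus "inv\<^bsub>SL2Q\<^esub> a \<in> stab \<Gamma> w" using I(1) by (simp only: stab_def mem_Collect_eq)
  fix b assume "b \<in> stab \<Gamma> w"
  hence bG: "b \<in> \<Gamma>" and bw: "moebius b w = w" by (auto simp: stab_def)
  have "moebius (a ** b) w = moebius a (moebius b w)"
    by (intro moebius_mult subgroup_det[OF assms(1)] aG bG assms(2))
  thus "a \<otimes>\<^bsub>SL2Q\<^esub> b \<in> stab \<Gamma> w"
    using subgroup.m_closed[OF assms(1) aG bG] by (simp add: stab_def aw bw)
qed

lemma stab_iff_afac:
  assumes "det \<gamma> = 1" "w \<notin> \<real>" "\<gamma> \<in> \<Gamma>"
  shows "\<gamma> \<in> stab \<Gamma> w \<longleftrightarrow> afac \<gamma> w w = 0"
  using assms jfac_nonzero[OF assms(1,2)] by (simp add: afac_eq stab_def)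

text \<open>Determinant 1 preserves the sign of the imaginary part, so \<open>w\<close> cannot be
  moved to its conjugate.\<close>

lemma afac_cnj_nonzero:
  assumes "det \<gamma> = 1" "w \<notin> \<real>"
  shows "afac \<gamma> (cnj w) w \<noteq> 0"
proof
  assume "afac \<gamma> (cnj w) w = 0"
  hence m: "moebius \<gamma> w = cnj w" using jfac_nonzero[OF assms] by (simp add: afac_eq[OF assms])
  have p: "0 < (norm (jfac \<gamma> w))\<^sup>2" using jfac_nonzero[OF assms] by simp
  have "Im w / (norm (jfac \<gamma> w))\<^sup>2 = - Im w" using Im_moebius[OF assms] by (simp add: m)
  hence "Im w * (1 + (norm (jfac \<gamma> w))\<^sup>2) = 0" using p by (simp add: field_simps)
  moreover have "1 + (norm (jfac \<gamma> w))\<^sup>2 \<noteq> 0" using p by linarith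
  ultimately show False using assms(2) by (simp add: complex_is_Real_iff)
qed

section \<open>The contribution of a single group element\<close>

definition term_form :: "complex \<Rightarrow> nat \<Rightarrow> rat^2^2 \<Rightarrow> complex \<Rightarrow> cpoly4" where
  "term_form w k \<gamma> z = (\<Sum>p\<le>k. Const (psi_term w p (k - p) \<gamma> z)
      * ((Indet IU - Const w * Indet IV) ^ p * (Indet IU - Const (cnj w) * Indet IV) ^ (k - p))
      * (Indet IX - Const z * Indet IY) ^ k)"

lemma term_form_meromorphic: "\<exists>R. has_poly_residue (term_form w k \<gamma>) z R"
proof -
  have "\<forall>p. \<exists>R. has_poly_residue (\<lambda>z. Const (psi_term w p (k - p) \<gamma> z)
      * ((Indet IU - Const w * Indet IV) ^ p * (Indet IU - Const (cnj w) * Indet IV) ^ (k - p))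
      * (Indet IX - Const z * Indet IY) ^ k) z R"
    by (intro allI has_poly_residue_linear_form(1) psi_term_meromorphic)
  from choice[OF this] obtain R where R: "\<forall>p. has_poly_residue (\<lambda>z. Const (psi_term w p (k - p) \<gamma> z)
      * ((Indet IU - Const w * Indet IV) ^ p * (Indet IU - Const (cnj w) * Indet IV) ^ (k - p))
      * (Indet IX - Const z * Indet IY) ^ k) z (R p)" ..
  have "has_poly_residue (term_form w k \<gamma>) z (\<Sum>p\<le>k. R p)"
    unfolding term_form_def [abs_def] by (rule has_poly_residue_sum) (rule R[rule_format])
  thus ?thesis ..
qed

lemma term_form_residue_0:
  assumes "afac \<gamma> w w \<noteq> 0" "afac \<gamma> (cnj w) w \<noteq> 0"
  shows "has_poly_residue (term_form w k \<gamma>) w 0"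
proof -
  have "psi_term w p q \<gamma> analytic_on {w}" for p q
    using assms unfolding psi_term_def [abs_def] afac_def jfac_def
    by (intro analytic_intros) auto
  hence "has_poly_residue (term_form w k \<gamma>) w (\<Sum>p\<le>k. 0)"
    unfolding term_form_def [abs_def]
    by (intro has_poly_residue_sum has_poly_residue_linear_form(2) psi_term_meromorphic)
  thus ?thesis by simp
qed

lemma lin_subst_one:
  "lin_subst \<gamma> (mat 1) IU = Indet IU" "lin_subst \<gamma> (mat 1) IV = Indet IV"
  "lin_subst (mat 1) \<gamma> IX = Indet IX" "lin_subst (mat 1) \<gamma> IY = Indet IY"
  by (simp_all add: mat_def)

text \<open>The columns (w, 1) and (cnj w, 1) are eigenvectors of \<open>\<gamma>\<close> with
  eigenvalues \<open>j\<close> and \<open>j'\<close>. Hence the two linear forms are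
  \<open>(z - w) / j\<close> and \<open>(z - cnj w) / j'\<close>, and the coefficients are those of
  the identity times \<open>j ^ p * j' ^ q\<close>. The inverse of \<open>\<gamma>\<close>, acting
  on (U, V), absorbs these factors.\<close>

lemma term_form_residue_stab:
  assumes det: "det \<gamma> = 1" and w: "w \<notin> \<real>" and fix_w: "moebius \<gamma> w = w"
  shows "has_poly_residue (term_form w k \<gamma>) w (bracket \<gamma> (mat 1) ^ k)"
proof -
  define a where "a = complex_of_rat (\<gamma> $ 1 $ 1)"
  define b where "b = complex_of_rat (\<gamma> $ 1 $ 2)"
  define c where "c = complex_of_rat (\<gamma> $ 2 $ 1)"
  define d where "d = complex_of_rat (\<gamma> $ 2 $ 2)"
  note abcd = a_def b_def c_def d_def
  have D: "a * d - b * c = 1"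
    using det by (simp add: det_2 abcd flip: of_rat_mult of_rat_diff)
  have cnj_rat: "cnj (complex_of_rat x) = of_rat x" for x by (metis complex_cnj_complex_of_real of_real_of_rat)
  define j where "j = c * w + d"
  define j' where "j' = c * cnj w + d"
  have jj: "j = jfac \<gamma> w" by (simp add: j_def jfac_def abcd)
  have j0: "j \<noteq> 0" using jfac_nonzero[OF det w] by (simp add: jj)
  have "cnj j = j'" by (simp add: j_def j'_def abcd cnj_rat)
  have ww: "w \<noteq> cnj w" using w by (metis Reals_cnj_iff)
  have e1: "w * j = a * w + b"
    using fix_w j0 by (simp add: moebius_def jj[symmetric] abcd[symmetric] field_simps)
  from arg_cong[OF this, of cnj] have e2: "cnj w * j' = a * cnj w + b"
    using \<open>cnj j = j'\<close> by (simp add: abcd cnj_rat)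
  \<comment> \<open>The product of the two eigenvalues is the determinant.\<close>
  have jj': "j * j' = 1"
  proof -
    have "(w - cnj w) * (j * j') = (w - cnj w) * 1"
      using e1 e2 D unfolding j_def j'_def by algebra
    thus ?thesis using ww by simp
  qed
  have f1: "(a - w * c) * j = 1" and f2: "(a - cnj w * c) * j' = 1"
    using e1 e2 D unfolding j_def j'_def by algebra+
  have af: "afac \<gamma> w z = (a - w * c) * (z - w)" "afac \<gamma> (cnj w) z = (a - cnj w * c) * (z - cnj w)" for z
    using e1 e2 unfolding afac_def jfac_def abcd[symmetric] j_def j'_def by algebra+
  have j'0: "j' \<noteq> 0" using jj' by auto
  have ac: "a - w * c = 1 / j" "a - cnj w * c = 1 / j'"
    using f1 f2 j0 j'0 by (simp_all add: field_simps)
  have pt: "psi_term w p q \<gamma> z = (w - cnj w) / ((z - w) ^ (p + 1) * (z - cnj w) ^ (q + 1)) * (j ^ p * j' ^ q)" for p q z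
  proof -
    have "psi_term w p q \<gamma> z = (w - cnj w) / ((z - w) ^ (p + 1) * (z - cnj w) ^ (q + 1)) * (j ^ (p + 1) * j' ^ (q + 1))"
      unfolding psi_term_def af ac by (simp add: power_divide)
    also have "j ^ (p + 1) * j' ^ (q + 1) = (j * j') * (j ^ p * j' ^ q)" by simp
    finally show ?thesis by (simp only: jj' mult_1)
  qed
  \<comment> \<open>The images of the indeterminates under the inverse of \<open>\<gamma>\<close>;
    sorting \<open>bracket \<gamma> (mat 1)\<close> by X and Y produces the same two
    polynomials.\<close>
  define U where "U = Const d * Indet IU - Const b * Indet IV"
  define V where "V = Const a * Indet IV - Const c * Indet IU"
  have lin: "U - Const u * V = Const (c * u + d) * (Indet IU - Const u * Indet IV)"
    if u: "u * (c * u + d) = a * u + b" for u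
  proof -
    have "U - Const u * V = Const (c * u + d) * Indet IU - Const (a * u + b) * Indet IV"
      unfolding U_def V_def Const_mult Const_add by (simp only: algebra_simps)
    also have "\<dots> = Const (c * u + d) * (Indet IU - Const u * Indet IV)"
      unfolding u[symmetric] Const_mult by (simp only: algebra_simps)
    finally show ?thesis .
  qed
  have A: "U - Const w * V = Const j * (Indet IU - Const w * Indet IV)"
    and B: "U - Const (cnj w) * V = Const j' * (Indet IU - Const (cnj w) * Indet IV)"
    using lin[of w] lin[of "cnj w"] e1 e2 by (simp_all add: j_def j'_def)
  have tf: "term_form w k \<gamma> z = (\<Sum>p\<le>k. Const ((w - cnj w) / ((z - w) ^ (p + 1) * (z - cnj w) ^ (k - p + 1)))
      * (U - Const w * V) ^ p * (U - Const (cnj w) * V) ^ (k - p)) * (Indet IX - Const z * Indet IY) ^ k" for z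
    unfolding term_form_def pt A B sum_distrib_right power_mult_distrib
    by (simp only: Const_mult Const_power mult_ac)
  have "bracket \<gamma> (mat 1) = Indet IX * V - Indet IY * U"
    unfolding bracket_def lin_subst_one unfolding lin_subst.simps abcd[symmetric] U_def V_def
    by (simp only: algebra_simps)
  thus ?thesis unfolding tf [abs_def] using identity_summand_residue[OF w, where U = U and V = V] by simp
qed

text \<open>Leaving \<open>R\<close> free covers two uses: at any non-real \<open>z0\<close> the
  mere existence of residues gives meromorphy, and at \<open>w\<close> the residues are
  known.\<close>

lemma Psi_form_local:
  assumes sub: "subgroup \<Gamma> SL2Q" and com: "commensurable SL2Q \<Gamma> SL2Z"
    and k: "k > 0" and w: "w \<notin> \<real>" and z0: "z0 \<notin> \<real>"
  obtains F where "finite F" "F \<subseteq> \<Gamma>" "\<And>\<gamma>. \<gamma> \<in> \<Gamma> - F \<Longrightarrow> afac \<gamma> w z0 \<noteq> 0"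
    "\<And>R. (\<And>\<gamma>. \<gamma> \<in> F \<Longrightarrow> has_poly_residue (term_form w k \<gamma>) z0 (R \<gamma>)) \<Longrightarrow>
        has_poly_residue (Psi_form \<Gamma> k w) z0 (\<Sum>\<gamma>\<in>F. R \<gamma>)"
proof -
  obtain F r where F: "finite F" "F \<subseteq> \<Gamma>" "0 < r" "\<And>\<gamma>. \<gamma> \<in> \<Gamma> - F \<Longrightarrow> afac \<gamma> w z0 \<noteq> 0"
    and H: "\<And>p q. p + q = k \<Longrightarrow> \<exists>H. H holomorphic_on ball z0 r \<and>
        (\<forall>z\<in>ball z0 r. Psi \<Gamma> p q z w = (\<Sum>\<gamma>\<in>F. psi_term w p q \<gamma> z) + H z)"
    using Psi_local[OF assms] by blast
  \<comment> \<open>The holomorphic remainder depends on \<open>p\<close>; the guard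
    \<open>p \<le> k\<close> makes the statement total, so that choice applies.\<close>
  have "\<forall>p. \<exists>H. p \<le> k \<longrightarrow> H holomorphic_on ball z0 r \<and>
        (\<forall>z\<in>ball z0 r. Psi \<Gamma> p (k - p) z w = (\<Sum>\<gamma>\<in>F. psi_term w p (k - p) \<gamma> z) + H z)"
  proof
    fix p
    show "\<exists>H. p \<le> k \<longrightarrow> H holomorphic_on ball z0 r \<and>
        (\<forall>z\<in>ball z0 r. Psi \<Gamma> p (k - p) z w = (\<Sum>\<gamma>\<in>F. psi_term w p (k - p) \<gamma> z) + H z)"
      by (cases "p \<le> k") (use H[of p "k - p"] in auto)
  qed
  from choice[OF this] obtain H where HH: "\<forall>p. p \<le> k \<longrightarrow> H p holomorphic_on ball z0 r \<and>
        (\<forall>z\<in>ball z0 r. Psi \<Gamma> p (k - p) z w = (\<Sum>\<gamma>\<in>F. psi_term w p (k - p) \<gamma> z) + H p z)" ..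
  hence hol: "\<And>p. p \<le> k \<Longrightarrow> H p holomorphic_on ball z0 r"
    and Psi: "\<And>p z. p \<le> k \<Longrightarrow> z \<in> ball z0 r \<Longrightarrow>
        Psi \<Gamma> p (k - p) z w = (\<Sum>\<gamma>\<in>F. psi_term w p (k - p) \<gamma> z) + H p z" by blast+
  define Q where "Q p = (Indet IU - Const w * Indet IV) ^ p * (Indet IU - Const (cnj w) * Indet IV) ^ (k - p)" for p
  define L where "L z = (Indet IX - Const z * Indet IY) ^ k" for z
  have eq: "Psi_form \<Gamma> k w z = (\<Sum>\<gamma>\<in>F. term_form w k \<gamma> z) + (\<Sum>p\<le>k. Const (H p z) * Q p * L z)"
    if z: "z \<in> ball z0 r" for z
  proof -
    have Csum: "Const (\<Sum>\<gamma>\<in>F. f \<gamma>) = (\<Sum>\<gamma>\<in>F. Const (f \<gamma>))" for f :: "rat^2^2 \<Rightarrow> complex"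
      by (induction F rule: infinite_finite_induct) (simp_all add: Const_add)
    have "Psi_form \<Gamma> k w z = (\<Sum>p\<le>k. Const (Psi \<Gamma> p (k - p) z w) * Q p * L z)"
      unfolding Psi_form_def Psi_poly_def sum_pairs_eq Q_def L_def by (simp add: sum_distrib_right mult.assoc)
    also have "\<dots> = (\<Sum>p\<le>k. (\<Sum>\<gamma>\<in>F. Const (psi_term w p (k - p) \<gamma> z) * Q p * L z) + Const (H p z) * Q p * L z)"
      by (intro sum.cong refl) (simp add: Psi[OF _ z] Const_add Csum distrib_right sum_distrib_right)
    also have "\<dots> = (\<Sum>p\<le>k. \<Sum>\<gamma>\<in>F. Const (psi_term w p (k - p) \<gamma> z) * Q p * L z) + (\<Sum>p\<le>k. Const (H p z) * Q p * L z)"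
      by (rule sum.distrib)
    also have "(\<Sum>p\<le>k. \<Sum>\<gamma>\<in>F. Const (psi_term w p (k - p) \<gamma> z) * Q p * L z) = (\<Sum>\<gamma>\<in>F. term_form w k \<gamma> z)"
      unfolding term_form_def Q_def L_def by (rule sum.swap)
    finally show ?thesis .
  qed
  show ?thesis
  proof (rule that[OF F(1,2,4)])
    fix R assume R: "\<And>\<gamma>. \<gamma> \<in> F \<Longrightarrow> has_poly_residue (term_form w k \<gamma>) z0 (R \<gamma>)"
    have an: "H p analytic_on {z0}" if "p \<le> k" for p
      using hol[OF that] F(3) by (metis analytic_at centre_in_ball open_ball)
    have tail: "has_poly_residue (\<lambda>z. \<Sum>p\<le>k. Const (H p z) * Q p * L z) z0 (\<Sum>p\<le>k. 0)"
      unfolding L_def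
      by (intro has_poly_residue_sum has_poly_residue_linear_form(2) analytic_on_imp_meromorphic_on an) auto
    have "has_poly_residue (\<lambda>z. \<Sum>\<gamma>\<in>F. term_form w k \<gamma> z) z0 (\<Sum>\<gamma>\<in>F. R \<gamma>)"
      by (intro has_poly_residue_sum R)
    from has_poly_residue_add[OF this tail]
    have "has_poly_residue (\<lambda>z. (\<Sum>\<gamma>\<in>F. term_form w k \<gamma> z) + (\<Sum>p\<le>k. Const (H p z) * Q p * L z)) z0 (\<Sum>\<gamma>\<in>F. R \<gamma>)"
      by simp
    moreover have "\<forall>\<^sub>F z in at z0. Psi_form \<Gamma> k w z = (\<Sum>\<gamma>\<in>F. term_form w k \<gamma> z) + (\<Sum>p\<le>k. Const (H p z) * Q p * L z)"
      using eventually_at_ball[OF F(3), of z0 UNIV] by eventually_elim (use eq in auto)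
    ultimately show "has_poly_residue (Psi_form \<Gamma> k w) z0 (\<Sum>\<gamma>\<in>F. R \<gamma>)"
      by (rule has_poly_residue_cong[rotated])
  qed
qed

text \<open>Stabilising matrices are those whose form vanishes at \<open>w\<close>, so they all lie
  in \<open>F\<close>; the stabiliser is therefore finite and the sum over it is not the default 0.
  The other members of \<open>F\<close> have both forms nonzero at \<open>w\<close> and leave no
  residue.\<close>

lemma Psi_form_residue:
  assumes sub: "subgroup \<Gamma> SL2Q" and com: "commensurable SL2Q \<Gamma> SL2Z"
    and k: "k > 0" and w: "w \<notin> \<real>"
  shows "has_poly_residue (Psi_form \<Gamma> k w) w (\<Sum>\<gamma>\<in>stab \<Gamma> w. bracket \<gamma> (mat 1) ^ k)"
proof -
  obtain F where F: "finite F" "F \<subseteq> \<Gamma>" "\<And>\<gamma>. \<gamma> \<in> \<Gamma> - F \<Longrightarrow> afac \<gamma> w w \<noteq> 0"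
    and R: "\<And>R. (\<And>\<gamma>. \<gamma> \<in> F \<Longrightarrow> has_poly_residue (term_form w k \<gamma>) w (R \<gamma>)) \<Longrightarrow>
        has_poly_residue (Psi_form \<Gamma> k w) w (\<Sum>\<gamma>\<in>F. R \<gamma>)"
    using Psi_form_local[OF sub com k w w] by blast
  have dG: "det \<gamma> = 1" if "\<gamma> \<in> \<Gamma>" for \<gamma> using subgroup_det[OF sub that] .
  have stab: "stab \<Gamma> w \<subseteq> F"
  proof
    fix \<gamma> assume "\<gamma> \<in> stab \<Gamma> w"
    moreover from this have "\<gamma> \<in> \<Gamma>" by (simp add: stab_def)
    ultimately show "\<gamma> \<in> F" using F(3)[of \<gamma>] stab_iff_afac[OF dG w] by blast
  qed
  have "has_poly_residue (Psi_form \<Gamma> k w) w (\<Sum>\<gamma>\<in>F. if \<gamma> \<in> stab \<Gamma> w then bracket \<gamma> (mat 1) ^ k else 0)"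
  proof (rule R)
    fix \<gamma> assume "\<gamma> \<in> F"
    hence G: "\<gamma> \<in> \<Gamma>" using F by auto
    show "has_poly_residue (term_form w k \<gamma>) w (if \<gamma> \<in> stab \<Gamma> w then bracket \<gamma> (mat 1) ^ k else 0)"
      using term_form_residue_stab[OF dG[OF G] w] term_form_residue_0[of \<gamma> w]
        stab_iff_afac[OF dG[OF G] w G] afac_cnj_nonzero[OF dG[OF G] w] by (auto simp: stab_def)
  qed
  also have "(\<Sum>\<gamma>\<in>F. if \<gamma> \<in> stab \<Gamma> w then bracket \<gamma> (mat 1) ^ k else 0) = (\<Sum>\<gamma>\<in>stab \<Gamma> w. bracket \<gamma> (mat 1) ^ k)"
    using stab F(1) by (simp add: sum.If_cases Int_absorb1)
  finally show ?thesis .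
qed

text \<open>Diagonal invariance under the inverse of \<open>\<gamma>\<close> moves the matrix from
  the first slot to the second as its inverse, and inversion permutes the group.\<close>

lemma bracket_sum_swap:
  assumes S: "subgroup S SL2Q"
  shows "(\<Sum>\<gamma>\<in>S. bracket \<gamma> (mat 1) ^ k) = (\<Sum>\<gamma>\<in>S. bracket (mat 1) \<gamma> ^ k)"
proof (rule sum.reindex_bij_witness[of _ "\<lambda>\<gamma>. inv\<^bsub>SL2Q\<^esub> \<gamma>" "\<lambda>\<gamma>. inv\<^bsub>SL2Q\<^esub> \<gamma>"])
  fix \<gamma> assume g: "\<gamma> \<in> S"
  have "bracket (inv\<^bsub>SL2Q\<^esub> \<gamma> ** \<gamma>) (inv\<^bsub>SL2Q\<^esub> \<gamma> ** mat 1) = bracket \<gamma> (mat 1)"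
    using subgroup_det[OF S] SL2Q_inv[OF S g] by (intro bracket_diagonal) auto
  thus "bracket (mat 1) (inv\<^bsub>SL2Q\<^esub> \<gamma>) ^ k = bracket \<gamma> (mat 1) ^ k" by (simp add: SL2Q_inv[OF S g])
qed (simp_all add: SL2Q_inv[OF S])

text \<open>The action produces \<open>bracket (\<gamma> ** \<delta>) \<delta>\<close>; diagonal
  invariance under the inverse of \<open>\<delta>\<close> turns this into the bracket of a conjugate
  of \<open>\<gamma>\<close> with the identity, and conjugation permutes \<open>S\<close>.\<close>

lemma bracket_sum_invariant:
  assumes S: "subgroup S SL2Q" and d: "\<delta> \<in> S"
  shows "slash (\<Sum>\<gamma>\<in>S. bracket \<gamma> (mat 1) ^ k) \<delta> \<delta> = (\<Sum>\<gamma>\<in>S. bracket \<gamma> (mat 1) ^ k)"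
proof -
  let ?i = "inv\<^bsub>SL2Q\<^esub> \<delta>"
  note I = SL2Q_inv[OF S d]
  have mc: "x ** y \<in> S" if "x \<in> S" "y \<in> S" for x y
    using subgroup.m_closed[OF S that] by simp
  have "slash (\<Sum>\<gamma>\<in>S. bracket \<gamma> (mat 1) ^ k) \<delta> \<delta> = (\<Sum>\<gamma>\<in>S. slash (bracket \<gamma> (mat 1) ^ k) \<delta> \<delta>)"
    unfolding slash_def by (rule poly_subst_sum)
  also have "\<dots> = (\<Sum>\<gamma>\<in>S. bracket (\<gamma> ** \<delta>) \<delta> ^ k)" by (simp add: slash_bracket)
  also have "\<dots> = (\<Sum>\<gamma>\<in>S. bracket \<gamma> (mat 1) ^ k)"
  proof (rule sum.reindex_bij_witness[of _ "\<lambda>\<gamma>. \<delta> ** \<gamma> ** ?i" "\<lambda>\<gamma>. ?i ** \<gamma> ** \<delta>"])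
    fix \<gamma> assume g: "\<gamma> \<in> S"
    show "\<delta> ** (?i ** \<gamma> ** \<delta>) ** ?i = \<gamma>" "?i ** (\<delta> ** \<gamma> ** ?i) ** \<delta> = \<gamma>"
      using I by (metis matrix_mul_assoc matrix_mul_lid matrix_mul_rid)+
    show "?i ** \<gamma> ** \<delta> \<in> S" "\<delta> ** \<gamma> ** ?i \<in> S" using g d I by (auto intro!: mc)
    have "bracket (?i ** (\<gamma> ** \<delta>)) (?i ** \<delta>) = bracket (\<gamma> ** \<delta>) \<delta>"
      using subgroup_det[OF S I(1)] by (rule bracket_diagonal)
    thus "bracket (?i ** \<gamma> ** \<delta>) (mat 1) ^ k = bracket (\<gamma> ** \<delta>) \<delta> ^ k"
      by (simp add: I matrix_mul_assoc)
  qed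
  finally show ?thesis .
qed

theorem theorem3p10:
  fixes \<Gamma> :: "(rat^2^2) set" and k :: nat and w :: complex
  assumes "subgroup \<Gamma> SL2Q"
    and "commensurable SL2Q \<Gamma> SL2Z"
    and "k > 0"
    and "w \<notin> \<real>"
  shows "poly_meromorphic_on (Psi_form \<Gamma> k w) (- \<real>) \<and>
    poly_residue (Psi_form \<Gamma> k w) w =
      (\<Sum>\<gamma>\<in>stab \<Gamma> w. slash ((Indet IX * Indet IV - Indet IY * Indet IU) ^ k) \<gamma> (mat 1)) \<and>
    (\<Sum>\<gamma>\<in>stab \<Gamma> w. slash ((Indet IX * Indet IV - Indet IY * Indet IU) ^ k) \<gamma> (mat 1)) =
      (\<Sum>\<gamma>\<in>stab \<Gamma> w. slash ((Indet IX * Indet IV - Indet IY * Indet IU) ^ k) (mat 1) \<gamma>) \<and>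
    poly_residue (Psi_form \<Gamma> k w) w \<in> VkVk_invariants k (stab \<Gamma> w)"
proof -
  have S: "subgroup (stab \<Gamma> w) SL2Q" using assms(1,4) by (rule stab_subgroup)
  have mer: "poly_meromorphic_on (Psi_form \<Gamma> k w) (- \<real>)"
  proof (rule poly_meromorphic_onI)
    fix z0 :: complex assume "z0 \<in> - \<real>"
    hence "z0 \<notin> \<real>" by simp
    then obtain F where "finite F" "F \<subseteq> \<Gamma>" "\<And>\<gamma>. \<gamma> \<in> \<Gamma> - F \<Longrightarrow> afac \<gamma> w z0 \<noteq> 0"
      and F: "\<And>R. (\<And>\<gamma>. \<gamma> \<in> F \<Longrightarrow> has_poly_residue (term_form w k \<gamma>) z0 (R \<gamma>)) \<Longrightarrow>
        has_poly_residue (Psi_form \<Gamma> k w) z0 (\<Sum>\<gamma>\<in>F. R \<gamma>)"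
      using Psi_form_local[OF assms] by blast
    have "\<forall>\<gamma>. \<exists>R. has_poly_residue (term_form w k \<gamma>) z0 R" using term_form_meromorphic by blast
    from choice[OF this] obtain R where "\<forall>\<gamma>. has_poly_residue (term_form w k \<gamma>) z0 (R \<gamma>)" ..
    thus "\<exists>R. has_poly_residue (Psi_form \<Gamma> k w) z0 R" using F[of R] by blast
  qed
  have res: "poly_residue (Psi_form \<Gamma> k w) w = (\<Sum>\<gamma>\<in>stab \<Gamma> w. bracket \<gamma> (mat 1) ^ k)"
    by (rule has_poly_residue_imp_poly_residue[OF Psi_form_residue[OF assms]])
  have "(\<Sum>\<gamma>\<in>stab \<Gamma> w. bracket \<gamma> (mat 1) ^ k) \<in> VkVk k"
    using bracket_power_VkVk unfolding VkVk_eq_bihomogeneous by (intro bihomogeneous_sum) auto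
  hence "poly_residue (Psi_form \<Gamma> k w) w \<in> VkVk_invariants k (stab \<Gamma> w)"
    unfolding res VkVk_invariants_def using bracket_sum_invariant[OF S] by blast
  thus ?thesis
    using mer res bracket_sum_swap[OF S] unfolding slash_bracket_power by simp
qed

end
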